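(* Let $k \ge 3$ be an integer, $M^0 = K(\mathfrak{sl}_2,k)$ and $M^{0,+} = K(\mathfrak{sl}_2,k)^{\langle\theta\rangle}$. Then the map defined by $$(M^{2j,j})^{\epsilon} \mapsto (-1)^{j+\epsilon}(M^{2j,j})^{\epsilon}\qquad (0 \le j \le \lfloor k/2 \rfloor,\ \epsilon \in \{0,1\})$$ is compatible with the fusion rules (F1)--(F4) listed in the context, and it induces an automorphism of order $2$ of the subalgebra of the fusion algebra of $M^{0,+}$ spanned by $(M^{2j,j})^{\epsilon}$ for $0 \le j \le \lfloor k/2 \rfloor$ and $\epsilon \in \{0,1\}$.
   Context: For an integer $k\ge 2$, let $L(k,i)$, $0\le i\le k$, be the irreducible integrable highest weight $\widehat{\mathfrak{sl}}_2$-modules of level $k$ with top level the $(i+1)$-dimensional irreducible $\mathfrak{sl}_2$-module, and let $h$ span the Cartan subalgebra of $\mathfrak{sl}_2$ (standard basis $h,e,f$). The parafermion vertex operator algebra $M^0=K(\mathfrak{sl}_2,k)$ is the commutant, in the simple affine vertex operator algebra $L(k,0)$, of the Heisenberg vertex operator algebra generated by $h$. For $0\le i\le k$ and $j\in\mathbb Z/k\mathbb Z$, $M^{i,j}$ is the irreducible $M^0$-module (well defined up to isomorphism) consisting of the $v\in L(k,i)$ with $h(0)v=(i-2j)v$ and $h(n)v=0$ for $n\ge1$. One has $M^{i,j}\cong M^{k-i,j-i}$, $M^0=M^{0,0}\cong M^{k,0}$, and the $M^{i,j}$ with $0\le j<i\le k$ form a complete set of inequivalent irreducible $M^0$-modules.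 Assume $k\ge3$. Then $\mathrm{Aut}(M^0)$ is generated by an involution $\theta$ (which negates the primary vector $W^3$ of weight $3$, unique up to scalar), and $M^{0,\pm}$ are its $\pm1$-eigenspaces in $M^0$. The $M^0$-modules $M^{2j,j}$, $0\le j\le\lfloor k/2\rfloor$, are called of $\sigma$-type. Each is a direct sum $M^{2j,j}=(M^{2j,j})^0\oplus(M^{2j,j})^1$ of two irreducible $M^{0,+}$-modules, where $(M^{2j,j})^0$ is the one containing the (one-dimensional) top level of $M^{2j,j}$. In particular $(M^{0,0})^0=M^{0,+}$ and $(M^{0,0})^1=M^{0,-}$. The following fusion rules over $M^{0,+}$ are known, and by commutativity and associativity they determine all fusion products among the $(M^{2j,j})^\epsilon$: (F1) $(M^{0,0})^{\epsilon_1}\boxtimes(M^{2j,j})^{\epsilon_2}=(M^{2j,j})^{\epsilon_1+\epsilon_2}$ for $0\le j\le\lfloor k/2\rfloor$, with $\epsilon_1+\epsilon_2$ taken modulo $2$. (F2) If $k\ge4$, $(M^{2,1})^0\boxtimes(M^{2j,j})^0=(M^{2(j-1),j-1})^0+(M^{2j,j})^1+(M^{2(j+1),j+1})^0$ for $1\le j\le\lfloor k/2\rfloor-1$. (F3) If $k$ is odd and $j=\lfloor k/2\rfloor$, $(M^{2,1})^0\boxtimes(M^{2j,j})^0=(M^{2(j-1),j-1})^0+(M^{2j,j})^1$. (F4) If $k$ is even, $(M^{2,1})^0\boxtimes(M^{k,k/2})^0=(M^{k-2,k/2-1})^0$. *)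

theory Defs
  imports Complex_Main "HOL-Library.Poly_Mapping" "HOL-Library.Function_Algebras"
begin

section \<open>Complex vector spaces\<close>

text \<open>
  Vector spaces are subspaces of a complex vector space of finitely supported functions.
  The type \<open>vec\<close> has countably infinite dimension.  Vertex operator algebras and
  their irreducible modules are countable-dimensional (countably many weight spaces, each of
  finite dimension), so each of them has an isomorphic copy inside \<open>vec\<close>; in
  particular isomorphism classes of irreducible modules may be formed inside this type.
\<close>

definition smult :: "complex \<Rightarrow> ('i \<Rightarrow>\<^sub>0 complex) \<Rightarrow> ('i \<Rightarrow>\<^sub>0 complex)" where
  "smult c x = Poly_Mapping.map ((*) c) x"

lemma lookup_smult [simp]: "Poly_Mapping.lookup (smult c x) i = c * Poly_Mapping.lookup x i"
  unfolding smult_def by transfer (simp add: when_def)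

interpretation vs: vector_space smult
  by unfold_locales (auto intro!: poly_mapping_eqI simp: lookup_add algebra_simps)

type_synonym vec = "nat \<Rightarrow>\<^sub>0 complex"

definition vfindim :: "vec set \<Rightarrow> bool" where
  "vfindim S \<longleftrightarrow> (\<exists>B. finite B \<and> S \<subseteq> vs.span B)"

definition linear_on :: "('i \<Rightarrow>\<^sub>0 complex) set \<Rightarrow> (('i \<Rightarrow>\<^sub>0 complex) \<Rightarrow> ('j \<Rightarrow>\<^sub>0 complex)) \<Rightarrow> bool" where
  "linear_on S g \<longleftrightarrow>
     (\<forall>x\<in>S. \<forall>y\<in>S. g (x + y) = g x + g y) \<and> (\<forall>c. \<forall>x\<in>S. g (smult c x) = smult c (g x))"


section \<open>Vertex operator algebras and modules\<close>

text \<open>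
  \<open>mode V u n v\<close> is the coefficient \<open>u\<^sub>n v\<close> in
  \<open>Y(u,z)v = \<Sum>\<^sub>n u\<^sub>n v z\<^sup>-\<^sup>n\<^sup>-\<^sup>1\<close>; values outside the carrier are irrelevant.
\<close>

record voa =
  vcar :: "vec set"
  vac :: vec
  mode :: "vec \<Rightarrow> int \<Rightarrow> vec \<Rightarrow> vec"
  conf :: vec

record vmod =
  mcar :: "vec set"
  act :: "vec \<Rightarrow> int \<Rightarrow> vec \<Rightarrow> vec"

text \<open>
  The component form of the Jacobi (Borcherds) identity.  \<open>P1, P2, P3\<close> are the actions of the
  algebra on the source spaces of \<open>v\<close> and \<open>w\<close> and on the target space, and \<open>I\<close> is the
  bilinear operation under consideration.  Its index type is \<open>int\<close> for vertex algebras and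
  modules and \<open>complex\<close> for intertwining operators.  Under the truncation
  conditions both sums have finite support, so \<open>Sum_any\<close> is the intended sum.
\<close>

definition jacobi ::
  "(vec \<Rightarrow> int \<Rightarrow> vec \<Rightarrow> vec) \<Rightarrow> (vec \<Rightarrow> int \<Rightarrow> vec \<Rightarrow> vec) \<Rightarrow> (vec \<Rightarrow> int \<Rightarrow> vec \<Rightarrow> vec) \<Rightarrow>
   (vec \<Rightarrow> 'n::ring_1 \<Rightarrow> vec \<Rightarrow> vec) \<Rightarrow> vec \<Rightarrow> vec \<Rightarrow> vec \<Rightarrow> bool" where
  "jacobi P1 P2 P3 I u v w \<longleftrightarrow> (\<forall>(l::int) (m::int) (n::'n).
     Sum_any (\<lambda>i::nat. smult ((of_int m :: complex) gchoose i)
        (I (P1 u (l + int i) v) (of_int m + n - of_nat i) w)) =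
     Sum_any (\<lambda>i::nat. smult ((-1) ^ i * ((of_int l :: complex) gchoose i))
        (P3 u (l + m - int i) (I v (n + of_nat i) w)
         - smult ((-1) powi l) (I v (of_int l + n - of_nat i) (P2 u (m + int i) w)))))"

definition bilinear_into ::
  "vec set \<Rightarrow> vec set \<Rightarrow> vec set \<Rightarrow> (vec \<Rightarrow> 'n \<Rightarrow> vec \<Rightarrow> vec) \<Rightarrow> bool" where
  "bilinear_into S T U I \<longleftrightarrow>
     (\<forall>u\<in>S. \<forall>n. \<forall>w\<in>T. I u n w \<in> U) \<and>
     (\<forall>u\<in>S. \<forall>n. linear_on T (I u n)) \<and> (\<forall>w\<in>T. \<forall>n. linear_on S (\<lambda>u. I u n w))"

definition Lop :: "voa \<Rightarrow> vmod \<Rightarrow> int \<Rightarrow> vec \<Rightarrow> vec" where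
  "Lop V M n = act M (conf V) (n + 1)"

definition wtspace :: "voa \<Rightarrow> vmod \<Rightarrow> complex \<Rightarrow> vec set" where
  "wtspace V M \<mu> = {w \<in> mcar M. Lop V M 0 w = smult \<mu> w}"

definition adjoint_mod :: "voa \<Rightarrow> vmod" where
  "adjoint_mod V = \<lparr>mcar = vcar V, act = mode V\<rparr>"

definition is_module :: "voa \<Rightarrow> vmod \<Rightarrow> bool" where
  "is_module V M \<longleftrightarrow>
     vs.subspace (mcar M) \<and>
     bilinear_into (vcar V) (mcar M) (mcar M) (act M) \<and>
     (\<forall>w\<in>mcar M. \<forall>n. act M (vac V) n w = (if n = -1 then w else 0)) \<and>
     (\<forall>u\<in>vcar V. \<forall>w\<in>mcar M. \<exists>N. \<forall>n\<ge>N. act M u n w = 0) \<and>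
     (\<forall>u\<in>vcar V. \<forall>v\<in>vcar V. \<forall>w\<in>mcar M. jacobi (mode V) (act M) (act M) (act M) u v w) \<and>
     (\<forall>u\<in>vcar V. \<forall>w\<in>mcar M. \<forall>n.
        act M (Lop V (adjoint_mod V) (-1) u) n w = smult (- of_int n) (act M u (n - 1) w)) \<and>
     mcar M = vs.span (\<Union>\<mu>. wtspace V M \<mu>) \<and>
     (\<forall>\<mu>. vfindim (wtspace V M \<mu>)) \<and>
     (\<forall>\<mu>. \<exists>N::nat. \<forall>n\<ge>N. wtspace V M (\<mu> - of_nat n) = {0})"

definition is_voa :: "voa \<Rightarrow> bool" where
  "is_voa V \<longleftrightarrow>
     is_module V (adjoint_mod V) \<and>
     vac V \<in> vcar V \<and> vac V \<noteq> 0 \<and> conf V \<in> vcar V \<and>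
     (\<forall>u\<in>vcar V. mode V u (-1) (vac V) = u \<and> (\<forall>n\<ge>0. mode V u n (vac V) = 0)) \<and>
     (\<exists>c. \<forall>v\<in>vcar V. \<forall>m n.
        Lop V (adjoint_mod V) m (Lop V (adjoint_mod V) n v)
        - Lop V (adjoint_mod V) n (Lop V (adjoint_mod V) m v)
        = smult (of_int (m - n)) (Lop V (adjoint_mod V) (m + n) v)
          + (if m + n = 0 then smult (of_int (m ^ 3 - m) / 12 * c) v else 0)) \<and>
     (\<forall>\<mu>. wtspace V (adjoint_mod V) \<mu> \<noteq> {0} \<longrightarrow> \<mu> \<in> \<int>) \<and>
     (\<exists>N::int. \<forall>n\<le>N. wtspace V (adjoint_mod V) (of_int n) = {0})"

definition irreducible_module :: "voa \<Rightarrow> vmod \<Rightarrow> bool" where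
  "irreducible_module V M \<longleftrightarrow>
     is_module V M \<and> mcar M \<noteq> {0} \<and>
     (\<forall>D. vs.subspace D \<and> D \<subseteq> mcar M \<and> (\<forall>u\<in>vcar V. \<forall>n. \<forall>w\<in>D. act M u n w \<in> D)
        \<longrightarrow> D = {0} \<or> D = mcar M)"

definition module_iso :: "voa \<Rightarrow> vmod \<Rightarrow> vmod \<Rightarrow> bool" where
  "module_iso V M N \<longleftrightarrow> (\<exists>g. bij_betw g (mcar M) (mcar N) \<and> linear_on (mcar M) g \<and>
     (\<forall>u\<in>vcar V. \<forall>n. \<forall>w\<in>mcar M. g (act M u n w) = act N u n (g w)))"

text \<open>
  The homogeneous vectors of lowest weight.  The weights of an irreducible module form a
  subset of a single class modulo the integers, so for such modules this is one weight space.
\<close>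

definition top_level :: "voa \<Rightarrow> vmod \<Rightarrow> vec set" where
  "top_level V M = {w. \<exists>\<mu>. w \<in> wtspace V M \<mu> \<and> wtspace V M \<mu> \<noteq> {0} \<and>
                          (\<forall>n::nat\<ge>1. wtspace V M (\<mu> - of_nat n) = {0})}"

definition automorphism :: "voa \<Rightarrow> (vec \<Rightarrow> vec) \<Rightarrow> bool" where
  "automorphism V g \<longleftrightarrow>
     bij_betw g (vcar V) (vcar V) \<and> linear_on (vcar V) g \<and>
     (\<forall>u\<in>vcar V. \<forall>n. \<forall>v\<in>vcar V. g (mode V u n v) = mode V (g u) n (g v)) \<and>
     g (vac V) = vac V \<and> g (conf V) = conf V"

definition fixed_voa :: "voa \<Rightarrow> (vec \<Rightarrow> vec) \<Rightarrow> voa" where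
  "fixed_voa V g = V\<lparr>vcar := {v \<in> vcar V. g v = v}\<rparr>"

definition primary :: "voa \<Rightarrow> complex \<Rightarrow> vec set" where
  "primary V \<mu> = {w \<in> wtspace V (adjoint_mod V) \<mu>. \<forall>n\<ge>1. Lop V (adjoint_mod V) n w = 0}"

inductive_set gen_subalg :: "voa \<Rightarrow> vec set \<Rightarrow> vec set" for V S where
  gen_vac: "vac V \<in> gen_subalg V S"
| gen_base: "v \<in> S \<Longrightarrow> v \<in> gen_subalg V S"
| gen_add: "u \<in> gen_subalg V S \<Longrightarrow> v \<in> gen_subalg V S \<Longrightarrow> u + v \<in> gen_subalg V S"
| gen_smult: "v \<in> gen_subalg V S \<Longrightarrow> smult c v \<in> gen_subalg V S"
| gen_mode: "u \<in> gen_subalg V S \<Longrightarrow> v \<in> gen_subalg V S \<Longrightarrow> mode V u n v \<in> gen_subalg V S"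

definition commutant :: "voa \<Rightarrow> vec set \<Rightarrow> vec set" where
  "commutant V U = {v \<in> vcar V. \<forall>u\<in>U. \<forall>n\<ge>0. mode V u n v = 0}"


section \<open>Fusion rules and the fusion algebra\<close>

text \<open>
  An intertwining operator of type \<open>(M3 / M1 M2)\<close> is recorded by its components,
  \<open>I(w1,z)w2 = \<Sum>\<^sub>n I w1 n w2 z\<^sup>-\<^sup>n\<^sup>-\<^sup>1\<close> with \<open>n\<close> complex.  Components are
  set to \<open>0\<close> outside the carriers, so that each operator has exactly one representing function.
\<close>

definition intertwiners ::
    "voa \<Rightarrow> vmod \<Rightarrow> vmod \<Rightarrow> vmod \<Rightarrow> (vec \<Rightarrow> complex \<Rightarrow> vec \<Rightarrow> vec) set" where
  "intertwiners V M1 M2 M3 = {I.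
     (\<forall>w1 n w2. w1 \<notin> mcar M1 \<or> w2 \<notin> mcar M2 \<longrightarrow> I w1 n w2 = 0) \<and>
     bilinear_into (mcar M1) (mcar M2) (mcar M3) I \<and>
     (\<forall>w1\<in>mcar M1. \<forall>w2\<in>mcar M2. \<forall>n. \<exists>N::nat. \<forall>m\<ge>N. I w1 (n + of_nat m) w2 = 0) \<and>
     (\<forall>u\<in>vcar V. \<forall>w1\<in>mcar M1. \<forall>w2\<in>mcar M2. jacobi (act M1) (act M2) (act M3) I u w1 w2) \<and>
     (\<forall>w1\<in>mcar M1. \<forall>w2\<in>mcar M2. \<forall>n.
        I (Lop V M1 (-1) w1) n w2 = smult (- n) (I w1 (n - 1) w2))}"

definition ismult ::
    "complex \<Rightarrow> (vec \<Rightarrow> complex \<Rightarrow> vec \<Rightarrow> vec) \<Rightarrow> (vec \<Rightarrow> complex \<Rightarrow> vec \<Rightarrow> vec)" where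
  "ismult c I = (\<lambda>w1 n w2. smult c (I w1 n w2))"

interpretation ivs: vector_space ismult
  by unfold_locales
    (simp_all add: ismult_def fun_eq_iff vs.scale_right_distrib vs.scale_left_distrib)

definition fusion_rule :: "voa \<Rightarrow> vmod \<Rightarrow> vmod \<Rightarrow> vmod \<Rightarrow> nat" where
  "fusion_rule V M1 M2 M3 = ivs.dim (intertwiners V M1 M2 M3)"

definition fclass :: "voa \<Rightarrow> vmod \<Rightarrow> vmod set" where
  "fclass V M = {N. irreducible_module V N \<and> module_iso V M N}"

definition irr_classes :: "voa \<Rightarrow> vmod set set" where
  "irr_classes V = fclass V ` {M. irreducible_module V M}"

text \<open>
  The fusion algebra has the isomorphism classes of irreducible modules as a basis over the
  complex numbers and the fusion rules as structure constants.  Fusion rules depend only on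
  isomorphism classes, so they are computed with arbitrary representatives.
\<close>

type_synonym fvec = "vmod set \<Rightarrow>\<^sub>0 complex"

definition fusion_space :: "voa \<Rightarrow> fvec set" where
  "fusion_space V = {x. Poly_Mapping.keys x \<subseteq> irr_classes V}"

definition fbasis :: "voa \<Rightarrow> vmod \<Rightarrow> fvec" where
  "fbasis V M = Poly_Mapping.single (fclass V M) 1"

definition fprod :: "voa \<Rightarrow> fvec \<Rightarrow> fvec \<Rightarrow> fvec" where
  "fprod V x y = (\<Sum>a\<in>Poly_Mapping.keys x. \<Sum>b\<in>Poly_Mapping.keys y. \<Sum>c\<in>irr_classes V.
     Poly_Mapping.single c (Poly_Mapping.lookup x a * Poly_Mapping.lookup y b *
       of_nat (fusion_rule V (SOME M. M \<in> a) (SOME M. M \<in> b) (SOME M. M \<in> c))))"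

text \<open>
  The finiteness, commutativity and associativity that make the fusion algebra a well-defined
  commutative associative algebra.  They are theorems for rational, \<open>C\<^sub>2\<close>-cofinite vertex
  operator algebras of CFT type.  Finiteness also excludes the value \<open>0\<close> which the library
  gives to an infinite dimension or an infinite sum.
\<close>

definition has_fusion_algebra :: "voa \<Rightarrow> bool" where
  "has_fusion_algebra V \<longleftrightarrow>
     finite (irr_classes V) \<and>
     (\<forall>M1 M2 M3. irreducible_module V M1 \<and> irreducible_module V M2 \<and> irreducible_module V M3
        \<longrightarrow> (\<exists>B. finite B \<and> intertwiners V M1 M2 M3 \<subseteq> ivs.span B)) \<and>
     (\<forall>x\<in>fusion_space V. \<forall>y\<in>fusion_space V. fprod V x y = fprod V y x) \<and>
     (\<forall>x\<in>fusion_space V. \<forall>y\<in>fusion_space V. \<forall>z\<in>fusion_space V.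
        fprod V (fprod V x y) z = fprod V x (fprod V y z))"

definition fusion_subalgebra :: "voa \<Rightarrow> fvec set \<Rightarrow> bool" where
  "fusion_subalgebra V S \<longleftrightarrow>
     vs.subspace S \<and> S \<subseteq> fusion_space V \<and> fbasis V (adjoint_mod V) \<in> S \<and>
     (\<forall>x\<in>S. \<forall>y\<in>S. fprod V x y \<in> S)"

definition algebra_automorphism :: "voa \<Rightarrow> fvec set \<Rightarrow> (fvec \<Rightarrow> fvec) \<Rightarrow> bool" where
  "algebra_automorphism V S \<sigma> \<longleftrightarrow>
     bij_betw \<sigma> S S \<and> linear_on S \<sigma> \<and>
     \<sigma> (fbasis V (adjoint_mod V)) = fbasis V (adjoint_mod V) \<and>
     (\<forall>x\<in>S. \<forall>y\<in>S. \<sigma> (fprod V x y) = fprod V (\<sigma> x) (\<sigma> y))"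

definition has_order_two :: "'a set \<Rightarrow> ('a \<Rightarrow> 'a) \<Rightarrow> bool" where
  "has_order_two S \<sigma> \<longleftrightarrow> (\<forall>x\<in>S. \<sigma> (\<sigma> x) = x) \<and> (\<exists>x\<in>S. \<sigma> x \<noteq> x)"


section \<open>Affine \<open>sl\<^sub>2\<close> and the parafermion vertex operator algebra\<close>

text \<open>
  \<open>H n, E n, F n\<close> are the operators \<open>h(n), e(n), f(n)\<close>; the central element acts as
  the level \<open>k\<close>, and the invariant form is \<open>(h,h) = 2, (e,f) = 1\<close>.
\<close>

definition affine_sl2_rep ::
    "nat \<Rightarrow> vec set \<Rightarrow> (int \<Rightarrow> vec \<Rightarrow> vec) \<Rightarrow> (int \<Rightarrow> vec \<Rightarrow> vec) \<Rightarrow> (int \<Rightarrow> vec \<Rightarrow> vec) \<Rightarrow> bool" where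
  "affine_sl2_rep k C H E F \<longleftrightarrow>
     vs.subspace C \<and>
     (\<forall>X\<in>{H, E, F}. \<forall>n. linear_on C (X n) \<and> (\<forall>v\<in>C. X n v \<in> C)) \<and>
     (\<forall>v\<in>C. \<forall>m n.
        H m (H n v) - H n (H m v) = (if m + n = 0 then smult (2 * of_int m * of_nat k) v else 0) \<and>
        H m (E n v) - E n (H m v) = smult 2 (E (m + n) v) \<and>
        H m (F n v) - F n (H m v) = smult (-2) (F (m + n) v) \<and>
        E m (F n v) - F n (E m v) =
          H (m + n) v + (if m + n = 0 then smult (of_int m * of_nat k) v else 0) \<and>
        E m (E n v) = E n (E m v) \<and>
        F m (F n v) = F n (F m v))"

text \<open>
  The irreducible integrable highest weight module \<open>L(k,i)\<close>: irreducible, with all real root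
  vectors locally nilpotent, a highest weight vector of weight \<open>i\<close>, and top
  level of dimension \<open>i + 1\<close>.
\<close>

definition is_Lki ::
    "nat \<Rightarrow> nat \<Rightarrow> vec set \<Rightarrow> (int \<Rightarrow> vec \<Rightarrow> vec) \<Rightarrow> (int \<Rightarrow> vec \<Rightarrow> vec) \<Rightarrow> (int \<Rightarrow> vec \<Rightarrow> vec) \<Rightarrow> bool" where
  "is_Lki k i C H E F \<longleftrightarrow>
     affine_sl2_rep k C H E F \<and>
     (\<forall>D. vs.subspace D \<and> D \<subseteq> C \<and> (\<forall>X\<in>{H, E, F}. \<forall>n. \<forall>v\<in>D. X n v \<in> D) \<longrightarrow> D = {0} \<or> D = C) \<and>
     (\<forall>v\<in>C. \<forall>n. \<exists>N. (E n ^^ N) v = 0 \<and> (F n ^^ N) v = 0) \<and>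
     (let T = {v \<in> C. \<forall>n\<ge>1. H n v = 0 \<and> E n v = 0 \<and> F n v = 0} in
        (\<exists>v\<in>T. v \<noteq> 0 \<and> E 0 v = 0 \<and> H 0 v = smult (of_nat i) v) \<and>
        vfindim T \<and> vs.dim T = i + 1)"

text \<open>
  The simple affine vertex operator algebra \<open>L(k,0)\<close> with its Sugawara conformal vector
  \<open>1/(2(k+2)) (1/2 h(-1)h + e(-1)f + f(-1)e)\<close>.
\<close>

definition is_affine_voa :: "nat \<Rightarrow> voa \<Rightarrow> vec \<Rightarrow> vec \<Rightarrow> vec \<Rightarrow> bool" where
  "is_affine_voa k V h e f \<longleftrightarrow>
     is_voa V \<and> h \<in> vcar V \<and> e \<in> vcar V \<and> f \<in> vcar V \<and>
     is_Lki k 0 (vcar V) (mode V h) (mode V e) (mode V f) \<and>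
     conf V = smult (1 / (2 * (of_nat k + 2)))
       (smult (1/2) (mode V h (-1) h) + mode V e (-1) f + mode V f (-1) e)"

definition is_affine_module :: "nat \<Rightarrow> nat \<Rightarrow> voa \<Rightarrow> vec \<Rightarrow> vec \<Rightarrow> vec \<Rightarrow> vmod \<Rightarrow> bool" where
  "is_affine_module k i V h e f W \<longleftrightarrow>
     is_module V W \<and> is_Lki k i (mcar W) (act W h) (act W e) (act W f)"

text \<open>
  The conformal vector of the commutant is the difference of the one of \<open>V\<close> and the one
  of the Heisenberg vertex operator algebra, \<open>1/(4k) h(-1)h\<close>.
\<close>

definition parafermion :: "nat \<Rightarrow> voa \<Rightarrow> vec \<Rightarrow> voa" where
  "parafermion k V h =
     V\<lparr>vcar := commutant V (gen_subalg V {h}),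
       conf := conf V - smult (1 / (4 * of_nat k)) (mode V h (-1) h)\<rparr>"

definition Mij :: "vec \<Rightarrow> (nat \<Rightarrow> vmod) \<Rightarrow> nat \<Rightarrow> int \<Rightarrow> vmod" where
  "Mij h W i j =
     \<lparr>mcar = {v \<in> mcar (W i). act (W i) h 0 v = smult (of_int (int i - 2 * j)) v \<and>
                             (\<forall>n\<ge>1. act (W i) h n v = 0)},
      act = act (W i)\<rparr>"

text \<open>\<open>Aut(M)\<close> is generated by the involution \<open>\<theta>\<close>, which negates the primary vectors of weight 3.\<close>

definition is_theta :: "voa \<Rightarrow> (vec \<Rightarrow> vec) \<Rightarrow> bool" where
  "is_theta M \<theta> \<longleftrightarrow>
     automorphism M \<theta> \<and> (\<forall>v\<in>vcar M. \<theta> (\<theta> v) = v) \<and> (\<exists>v\<in>vcar M. \<theta> v \<noteq> v) \<and>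
     (\<forall>g. automorphism M g \<longrightarrow> (\<forall>v\<in>vcar M. g v = v) \<or> (\<forall>v\<in>vcar M. g v = \<theta> v)) \<and>
     (\<forall>w\<in>primary M 3. \<theta> w = - w)"

text \<open>
  The decomposition of an \<open>M0\<close>-module \<open>N\<close> of \<open>\<sigma>\<close>-type into irreducible modules over the
  fixed-point subalgebra \<open>Mp\<close>; \<open>A \<epsilon>\<close> is the carrier of \<open>N\<^sup>\<epsilon>\<close>.
\<close>

definition sigma_split :: "voa \<Rightarrow> voa \<Rightarrow> vmod \<Rightarrow> (nat \<Rightarrow> vec set) \<Rightarrow> bool" where
  "sigma_split M0 Mp N A \<longleftrightarrow>
     irreducible_module Mp (N\<lparr>mcar := A 0\<rparr>) \<and> irreducible_module Mp (N\<lparr>mcar := A 1\<rparr>) \<and>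
     A 0 \<inter> A 1 = {0} \<and> mcar N = {x + y | x y. x \<in> A 0 \<and> y \<in> A 1} \<and>
     vs.dim (top_level M0 N) = 1 \<and> top_level M0 N \<subseteq> A 0"


section \<open>The listed fusion rules\<close>

text \<open>
  \<open>pr\<close> is the product and \<open>B j \<epsilon>\<close> stands for the element attached to \<open>(M\<^sup>2\<^sup>j\<^sup>,\<^sup>j)\<^sup>\<epsilon>\<close>.
\<close>

definition F1 :: "(fvec \<Rightarrow> fvec \<Rightarrow> fvec) \<Rightarrow> nat \<Rightarrow> (nat \<Rightarrow> nat \<Rightarrow> fvec) \<Rightarrow> bool" where
  "F1 pr k B \<longleftrightarrow> (\<forall>j \<epsilon>1 \<epsilon>2. j \<le> k div 2 \<and> \<epsilon>1 \<in> {0,1} \<and> \<epsilon>2 \<in> {0,1} \<longrightarrow>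
     pr (B 0 \<epsilon>1) (B j \<epsilon>2) = B j ((\<epsilon>1 + \<epsilon>2) mod 2))"

definition F2 :: "(fvec \<Rightarrow> fvec \<Rightarrow> fvec) \<Rightarrow> nat \<Rightarrow> (nat \<Rightarrow> nat \<Rightarrow> fvec) \<Rightarrow> bool" where
  "F2 pr k B \<longleftrightarrow> (4 \<le> k \<longrightarrow> (\<forall>j. 1 \<le> j \<and> j \<le> k div 2 - 1 \<longrightarrow>
     pr (B 1 0) (B j 0) = B (j - 1) 0 + B j 1 + B (j + 1) 0))"

definition F3 :: "(fvec \<Rightarrow> fvec \<Rightarrow> fvec) \<Rightarrow> nat \<Rightarrow> (nat \<Rightarrow> nat \<Rightarrow> fvec) \<Rightarrow> bool" where
  "F3 pr k B \<longleftrightarrow> (odd k \<longrightarrow>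
     pr (B 1 0) (B (k div 2) 0) = B (k div 2 - 1) 0 + B (k div 2) 1)"

definition F4 :: "(fvec \<Rightarrow> fvec \<Rightarrow> fvec) \<Rightarrow> nat \<Rightarrow> (nat \<Rightarrow> nat \<Rightarrow> fvec) \<Rightarrow> bool" where
  "F4 pr k B \<longleftrightarrow> (even k \<longrightarrow> pr (B 1 0) (B (k div 2) 0) = B (k div 2 - 1) 0)"

definition signed :: "(nat \<Rightarrow> nat \<Rightarrow> fvec) \<Rightarrow> nat \<Rightarrow> nat \<Rightarrow> fvec" where
  "signed B j \<epsilon> = smult ((-1) ^ (j + \<epsilon>)) (B j \<epsilon>)"

end

theory Submission
  imports Defs
begin

text \<open>
  The rule \<open>(M\<^sup>2\<^sup>j\<^sup>,\<^sup>j)\<^sup>\<epsilon> \<mapsto> (-1)\<^sup>j\<^sup>+\<^sup>\<epsilon> (M\<^sup>2\<^sup>j\<^sup>,\<^sup>j)\<^sup>\<epsilon>\<close> respects the parity of \<open>j + \<epsilon>\<close>, and every listed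
  fusion product is homogeneous for that parity: \<open>(j, \<epsilon>)\<close> times \<open>(i, \<delta>)\<close> only yields terms of parity
  \<open>j + \<epsilon> + i + \<delta>\<close>.  So the listed rules survive the change of signs.  Write \<open>s\<close>, \<open>x\<close>, \<open>y\<^sub>j\<close> for the
  classes of \<open>(M\<^sup>0\<^sup>,\<^sup>0)\<^sup>1\<close>, \<open>(M\<^sup>2\<^sup>,\<^sup>1)\<^sup>0\<close> and \<open>(M\<^sup>2\<^sup>j\<^sup>,\<^sup>j)\<^sup>0\<close>.  The second listed rule reads
  \<open>y\<^sub>j\<^sub>+\<^sub>1 = x y\<^sub>j - s y\<^sub>j - y\<^sub>j\<^sub>-\<^sub>1\<close>, so \<open>s\<close> and \<open>x\<close> generate the span as an algebra, and multiplicativity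
  has to be checked for these two elements only (locale \<open>sigma_type_fusion\<close>).

  What remains is that the sign rule defines a linear map at all.  The fusion algebra has the
  isomorphism classes as a basis, so this needs that the modules \<open>(M\<^sup>2\<^sup>j\<^sup>,\<^sup>j)\<^sup>\<epsilon>\<close> are pairwise
  inequivalent over \<open>M\<^sup>0\<^sup>,\<^sup>+\<close> (\<open>half_class_distinct\<close>).  The fusion rules alone do not imply it: for
  \<open>k = 4\<close> they are also satisfied in the representation ring of the symmetric group on three letters,
  with \<open>s = y\<^sub>2\<close> the sign character and \<open>x = s x\<close> the two-dimensional one.

  The two halves of one \<open>M\<^sup>2\<^sup>j\<^sup>,\<^sup>j\<close> differ because an isomorphism between them would preserve weights
  and hence move the top level of \<open>M\<^sup>2\<^sup>j\<^sup>,\<^sup>j\<close> out of the half that contains it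
  (\<open>top_level_separates_halves\<close>).  This uses that the conformal vector of \<open>M\<^sup>0\<close> lies in \<open>M\<^sup>0\<^sup>,\<^sup>+\<close>, which
  is a computation with the Sugawara vector (\<open>coset_conformal_vector\<close>).

  Two halves \<open>D \<subseteq> M\<^sup>2\<^sup>i\<^sup>,\<^sup>i\<close> and \<open>D' \<subseteq> M\<^sup>2\<^sup>j\<^sup>,\<^sup>j\<close> with \<open>i \<noteq> j\<close> differ because an isomorphism \<open>\<phi>\<close> between
  them would extend to an isomorphism of \<open>M\<^sup>0\<close>-modules.  First, \<open>M\<^sup>0\<^sup>,\<^sup>-\<close> exchanges the two halves
  of each \<open>M\<^sup>2\<^sup>j\<^sup>,\<^sup>j\<close>: otherwise the action followed by a projection would be a nonzero intertwining
  operator, which the first listed rule forbids now that the two halves are known to differ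
  (\<open>odd_part_swaps_halves\<close>).  Then the
  \<open>M\<^sup>0\<close>-submodule of \<open>M\<^sup>2\<^sup>i\<^sup>,\<^sup>i \<oplus> M\<^sup>2\<^sup>j\<^sup>,\<^sup>j\<close> generated by the graph of \<open>\<phi>\<close> meets \<open>D \<oplus> D'\<close> in that graph
  only, so by irreducibility it is itself the graph of an isomorphism (\<open>extends\<close>).  This
  contradicts the inequivalence of the \<open>M\<^sup>2\<^sup>j\<^sup>,\<^sup>j\<close> over \<open>M\<^sup>0\<close>.
\<close>


section \<open>Vertex algebra actions and consequences of the Jacobi identity\<close>

lemma linear_on_add: "linear_on S g \<Longrightarrow> x \<in> S \<Longrightarrow> y \<in> S \<Longrightarrow> g (x + y) = g x + g y"
  by (simp add: linear_on_def)

lemma linear_on_smult: "linear_on S g \<Longrightarrow> x \<in> S \<Longrightarrow> g (smult c x) = smult c (g x)"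
  by (simp add: linear_on_def)

lemma linear_on_0: "linear_on S g \<Longrightarrow> vs.subspace S \<Longrightarrow> g 0 = 0"
  using linear_on_smult[of S g 0 0] vs.subspace_0[of S] by simp

lemma linear_on_minus:
  assumes "linear_on S g" "x \<in> S"
  shows "g (- x) = - g x"
  using linear_on_smult[OF assms, of "-1"] by simp

lemma linear_on_diff:
  assumes "linear_on S g" "vs.subspace S" "x \<in> S" "y \<in> S"
  shows "g (x - y) = g x - g y"
  using linear_on_add[OF assms(1), of x "- y"] linear_on_minus[OF assms(1,4)] assms
  by (simp add: vs.subspace_neg)

lemma linear_on_sum:
  assumes "linear_on S g" "vs.subspace S" "\<And>i. i \<in> I \<Longrightarrow> f i \<in> S"
  shows "g (\<Sum>i\<in>I. f i) = (\<Sum>i\<in>I. g (f i))"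
  using assms(3)
proof (induction I rule: infinite_finite_induct)
  case (insert x F)
  then show ?case
    using linear_on_add[OF assms(1)] vs.subspace_sum[OF assms(2), of F f] by simp
qed (simp_all add: linear_on_0[OF assms(1,2)])

lemma Sum_any_lessThan:
  fixes f :: "nat \<Rightarrow> 'a::comm_monoid_add"
  assumes "\<And>i. i \<ge> K \<Longrightarrow> f i = 0"
  shows "Sum_any f = (\<Sum>i<K. f i)"
  by (rule Sum_any.expand_superset) (use assms in \<open>auto simp: not_less[symmetric]\<close>)

lemma eventually_zero_add:
  assumes "\<exists>N. \<forall>n\<ge>N. f n = (0::'a::zero)"
  shows "\<exists>N. \<forall>i\<ge>N. f (a + int i) = 0"
proof -
  obtain N where N: "\<forall>n\<ge>N. f n = 0" using assms by blast
  show ?thesis by (rule exI[of _ "nat (N - a)"]) (use N in auto)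
qed

text \<open>
  The algebraic part of the module axioms, without weights.  It passes to subalgebras and stable
  subspaces, which the grading conditions do not do without further argument.
\<close>

locale vertex_action =
  fixes V :: voa and M :: vmod
  assumes alg_subspace: "vs.subspace (vcar V)"
    and mod_subspace: "vs.subspace (mcar M)"
    and alg_closed: "u \<in> vcar V \<Longrightarrow> v \<in> vcar V \<Longrightarrow> mode V u n v \<in> vcar V"
    and bilinear: "bilinear_into (vcar V) (mcar M) (mcar M) (act M)"
    and alg_trunc: "u \<in> vcar V \<Longrightarrow> v \<in> vcar V \<Longrightarrow> \<exists>N. \<forall>n\<ge>N. mode V u n v = 0"
    and trunc: "u \<in> vcar V \<Longrightarrow> w \<in> mcar M \<Longrightarrow> \<exists>N. \<forall>n\<ge>N. act M u n w = 0"
    and jac: "u \<in> vcar V \<Longrightarrow> v \<in> vcar V \<Longrightarrow> w \<in> mcar M \<Longrightarrow>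
      jacobi (mode V) (act M) (act M) (act M) u v w"
begin

lemma closed: "u \<in> vcar V \<Longrightarrow> w \<in> mcar M \<Longrightarrow> act M u n w \<in> mcar M"
  using bilinear by (simp add: bilinear_into_def)

lemma linear2: "u \<in> vcar V \<Longrightarrow> linear_on (mcar M) (act M u n)"
  using bilinear by (simp add: bilinear_into_def)

lemma linear1: "w \<in> mcar M \<Longrightarrow> linear_on (vcar V) (\<lambda>u. act M u n w)"
  using bilinear by (simp add: bilinear_into_def)

lemma act_zero2 [simp]: "u \<in> vcar V \<Longrightarrow> act M u n 0 = 0"
  using linear_on_0[OF linear2 mod_subspace] by simp

lemma act_zero1 [simp]: "w \<in> mcar M \<Longrightarrow> act M 0 n w = 0"
  using linear_on_0[OF linear1 alg_subspace] by simp

lemma Jacobi: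
  assumes "u \<in> vcar V" "v \<in> vcar V" "w \<in> mcar M"
  shows "Sum_any (\<lambda>i. smult ((of_int m) gchoose i)
        (act M (mode V u (l + int i) v) (m + n - int i) w)) =
     Sum_any (\<lambda>i. smult ((-1) ^ i * ((of_int l) gchoose i))
        (act M u (l + m - int i) (act M v (n + int i) w)
         - smult ((-1) powi l) (act M v (l + n - int i) (act M u (m + int i) w))))"
  using jac[OF assms] unfolding jacobi_def by simp

lemma commute:
  assumes "u \<in> vcar V" "v \<in> vcar V" "w \<in> mcar M" "\<And>i. i \<ge> 0 \<Longrightarrow> mode V u i v = 0"
  shows "act M u m (act M v n w) = act M v n (act M u m w)"
proof -
  have "Sum_any (\<lambda>i. smult ((of_int m) gchoose i)
        (act M (mode V u (0 + int i) v) (m + n - int i) w)) = 0"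
    using assms by simp
  then have "Sum_any (\<lambda>i. smult ((-1) ^ i * ((of_int 0) gchoose i))
        (act M u (0 + m - int i) (act M v (n + int i) w)
         - smult ((-1) powi 0) (act M v (0 + n - int i) (act M u (m + int i) w)))) = 0"
    using Jacobi[OF assms(1-3), of m 0 n] by simp
  also have "Sum_any (\<lambda>i. smult ((-1) ^ i * ((of_int 0) gchoose i))
        (act M u (0 + m - int i) (act M v (n + int i) w)
         - smult ((-1) powi 0) (act M v (0 + n - int i) (act M u (m + int i) w))))
     = act M u m (act M v n w) - act M v n (act M u m w)"
    by (subst Sum_any_lessThan[of 1]) (auto simp: gbinomial_0_left)
  finally show ?thesis by simp
qed

text \<open>
  Annihilation by all nonnegative modes passes from \<open>u\<close> and \<open>v\<close> to \<open>u\<^sub>p v\<close>; hence a vector killed by the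
  generators of a vertex subalgebra is killed by all of it.
\<close>

lemma iterate_zero:
  assumes "u \<in> vcar V" "v \<in> vcar V" "w \<in> mcar M"
    and "\<And>n. n \<ge> 0 \<Longrightarrow> act M u n w = 0" "\<And>n. n \<ge> 0 \<Longrightarrow> act M v n w = 0" and "n \<ge> 0"
  shows "act M (mode V u p v) n w = 0"
proof -
  have "Sum_any (\<lambda>i. smult ((-1) ^ i * ((of_int p) gchoose i))
        (act M u (p + 0 - int i) (act M v (n + int i) w)
         - smult ((-1) powi p) (act M v (p + n - int i) (act M u (0 + int i) w)))) = 0"
    using assms by simp
  moreover have "Sum_any (\<lambda>i. smult ((of_int 0) gchoose i)
        (act M (mode V u (p + int i) v) (0 + n - int i) w)) = act M (mode V u p v) n w"
    by (subst Sum_any_lessThan[of 1]) (auto simp: gbinomial_0_left)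
  ultimately show ?thesis
    using Jacobi[OF assms(1-3), of 0 p n] by simp
qed

text \<open>
  Associativity in the form used below: for \<open>m\<close> beyond the truncation index of \<open>u\<close> on \<open>w\<close>, the second
  half of the Jacobi identity vanishes.  Then \<open>u\<^sub>p v\<^sub>q w\<close> equals a combination of products
  \<open>(u\<^sub>i v)\<^sub>j w\<close> up to terms \<open>u\<^sub>p\<^sub>-\<^sub>i v\<^sub>q\<^sub>+\<^sub>i w\<close> with a larger second index, which invites an induction.
  The bounds \<open>m\<close> and \<open>K'\<close> are left free above a threshold so that two modules can share the same
  coefficients.
\<close>

lemma product_formula:
  assumes "u \<in> vcar V" "v \<in> vcar V" "w \<in> mcar M"
  shows "\<exists>N. \<forall>m\<ge>N. \<exists>K. \<forall>K'\<ge>K. act M u p (act M v q w)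
    = (\<Sum>i<K'. smult ((of_int m) gchoose i)
         (act M (mode V u (p - m + int i) v) (m + q - int i) w))
      - (\<Sum>i\<in>{1..<K'}. smult ((-1) ^ i * ((of_int (p - m)) gchoose i))
           (act M u (p - int i) (act M v (q + int i) w)))"
proof -
  obtain N where N: "\<And>n. n \<ge> N \<Longrightarrow> act M u n w = 0" using trunc[OF assms(1,3)] by blast
  have "\<exists>K. \<forall>K'\<ge>K. act M u p (act M v q w)
    = (\<Sum>i<K'. smult ((of_int m) gchoose i)
         (act M (mode V u (p - m + int i) v) (m + q - int i) w))
      - (\<Sum>i\<in>{1..<K'}. smult ((-1) ^ i * ((of_int (p - m)) gchoose i))
           (act M u (p - int i) (act M v (q + int i) w)))" if m: "m \<ge> N" for m
  proof -
    obtain K1 where K1: "\<And>i. i \<ge> K1 \<Longrightarrow> mode V u (p - m + int i) v = 0"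
      using eventually_zero_add[OF alg_trunc[OF assms(1,2)], of "p - m"] by blast
    obtain K2 where K2: "\<And>i. i \<ge> K2 \<Longrightarrow> act M v (q + int i) w = 0"
      using eventually_zero_add[OF trunc[OF assms(2,3)], of q] by blast
    show ?thesis
    proof (intro exI[of _ "Suc (max K1 K2)"] allI impI)
      fix K' assume K': "K' \<ge> Suc (max K1 K2)"
      have "Sum_any (\<lambda>i. smult ((of_int m) gchoose i)
          (act M (mode V u (p - m + int i) v) (m + q - int i) w)) =
        (\<Sum>i<K'. smult ((of_int m) gchoose i)
          (act M (mode V u (p - m + int i) v) (m + q - int i) w))"
        by (rule Sum_any_lessThan) (use K' K1 assms in auto)
      moreover have "Sum_any (\<lambda>i. smult ((-1) ^ i * ((of_int (p - m)) gchoose i))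
        (act M u (p - m + m - int i) (act M v (q + int i) w)
         - smult ((-1) powi (p - m)) (act M v (p - m + q - int i) (act M u (m + int i) w)))) =
        (\<Sum>i<K'. smult ((-1) ^ i * ((of_int (p - m)) gchoose i))
        (act M u (p - int i) (act M v (q + int i) w)))"
        using m assms N by (subst Sum_any_lessThan[of K']) (use K' K2 in auto)
      moreover have "(\<Sum>i<K'. smult ((-1) ^ i * ((of_int (p - m)) gchoose i))
        (act M u (p - int i) (act M v (q + int i) w))) = act M u p (act M v q w) +
          (\<Sum>i\<in>{1..<K'}. smult ((-1) ^ i * ((of_int (p - m)) gchoose i))
        (act M u (p - int i) (act M v (q + int i) w)))"
        using K' by (subst sum.remove[of _ 0]) (auto intro!: sum.cong)
      ultimately show "act M u p (act M v q w)
        = (\<Sum>i<K'. smult ((of_int m) gchoose i)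
             (act M (mode V u (p - m + int i) v) (m + q - int i) w))
          - (\<Sum>i\<in>{1..<K'}. smult ((-1) ^ i * ((of_int (p - m)) gchoose i))
               (act M u (p - int i) (act M v (q + int i) w)))"
        using Jacobi[OF assms, of m "p - m" q] by (simp add: algebra_simps)
    qed
  qed
  then show ?thesis by blast
qed

text \<open>
  Here too the upper summation bound is free, so that one formula serves two modules at a time.
\<close>

lemma commutator_formula:
  assumes "u \<in> vcar V" "v \<in> vcar V" "w \<in> mcar M"
  shows "\<exists>K. \<forall>K'\<ge>K. act M u m (act M v n w) = act M v n (act M u m w) +
     (\<Sum>i<K'. smult ((of_int m) gchoose i) (act M (mode V u (int i) v) (m + n - int i) w))"
proof -
  obtain K where K: "\<And>i. i \<ge> K \<Longrightarrow> mode V u (0 + int i) v = 0"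
    using eventually_zero_add[OF alg_trunc[OF assms(1,2)], of 0] by blast
  show ?thesis
  proof (intro exI[of _ K] allI impI)
    fix K' assume "K' \<ge> K"
    then have "Sum_any (\<lambda>i. smult ((of_int m) gchoose i)
        (act M (mode V u (0 + int i) v) (m + n - int i) w)) =
      (\<Sum>i<K'. smult ((of_int m) gchoose i) (act M (mode V u (int i) v) (m + n - int i) w))"
      by (subst Sum_any_lessThan[of K']) (use K assms in auto)
    moreover have "Sum_any (\<lambda>i. smult ((-1) ^ i * ((of_int 0) gchoose i))
        (act M u (0 + m - int i) (act M v (n + int i) w)
         - smult ((-1) powi 0) (act M v (0 + n - int i) (act M u (m + int i) w))))
     = act M u m (act M v n w) - act M v n (act M u m w)"
      by (subst Sum_any_lessThan[of 1]) (auto simp: gbinomial_0_left)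
    ultimately show "act M u m (act M v n w) = act M v n (act M u m w) +
      (\<Sum>i<K'. smult ((of_int m) gchoose i) (act M (mode V u (int i) v) (m + n - int i) w))"
      using Jacobi[OF assms, of m 0 n] by (simp add: algebra_simps)
  qed
qed

end

section \<open>Extending isomorphisms of even parts\<close>

text \<open>
  Irreducibility without the module axioms: unlike those, it is visibly transported by isomorphisms,
  which is how \<open>M\<^sup>0\<^sup>,\<^sup>0\<close> inherits it from \<open>M\<^sup>k\<^sup>,\<^sup>0\<close>.
\<close>

definition simple_action :: "voa \<Rightarrow> vmod \<Rightarrow> bool" where
  "simple_action V M \<longleftrightarrow> mcar M \<noteq> {0} \<and>
     (\<forall>D. vs.subspace D \<and> D \<subseteq> mcar M \<and> (\<forall>u\<in>vcar V. \<forall>n. \<forall>w\<in>D. act M u n w \<in> D)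
        \<longrightarrow> D = {0} \<or> D = mcar M)"

lemma simple_actionD:
  assumes "simple_action V M" "vs.subspace D" "D \<subseteq> mcar M"
    "\<And>u n w. u \<in> vcar V \<Longrightarrow> w \<in> D \<Longrightarrow> act M u n w \<in> D"
  shows "D = {0} \<or> D = mcar M"
  using assms unfolding simple_action_def by blast

lemma module_iso_refl: "module_iso V M M"
  unfolding module_iso_def by (rule exI[of _ id]) (auto simp: linear_on_def)

lemma module_iso_sym:
  assumes "module_iso V M N" "vs.subspace (mcar M)"
    "\<And>u n w. u \<in> vcar V \<Longrightarrow> w \<in> mcar M \<Longrightarrow> act M u n w \<in> mcar M"
  shows "module_iso V N M"
proof -
  obtain g where g: "bij_betw g (mcar M) (mcar N)" "linear_on (mcar M) g"
      "\<And>u n w. u \<in> vcar V \<Longrightarrow> w \<in> mcar M \<Longrightarrow> g (act M u n w) = act N u n (g w)"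
    using assms(1) unfolding module_iso_def by blast
  define h where "h = inv_into (mcar M) g"
  have inv: "h (g x) = x" if "x \<in> mcar M" for x
    using that g(1) by (simp add: h_def bij_betw_inv_into_left)
  have ex: "\<exists>x\<in>mcar M. y = g x" if "y \<in> mcar N" for y
    using that g(1) by (auto simp: bij_betw_def)
  have "bij_betw h (mcar N) (mcar M)" unfolding h_def by (rule bij_betw_inv_into[OF g(1)])
  moreover have "linear_on (mcar N) h"
    unfolding linear_on_def
  proof (intro conjI allI ballI)
    fix x y assume "x \<in> mcar N" "y \<in> mcar N"
    then obtain x' y' where *: "x' \<in> mcar M" "y' \<in> mcar M" "x = g x'" "y = g y'"
      using ex by blast
    then have "x + y = g (x' + y')" "x' + y' \<in> mcar M"
      using linear_on_add[OF g(2)] vs.subspace_add[OF assms(2)] by auto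
    then show "h (x + y) = h x + h y" using * inv by simp
  next
    fix c x assume "x \<in> mcar N"
    then obtain x' where *: "x' \<in> mcar M" "x = g x'" using ex by blast
    then have "smult c x = g (smult c x')" "smult c x' \<in> mcar M"
      using linear_on_smult[OF g(2)] vs.subspace_scale[OF assms(2)] by auto
    then show "h (smult c x) = smult c (h x)" using * inv by simp
  qed
  moreover have "h (act N u n w) = act M u n (h w)" if u: "u \<in> vcar V" and w: "w \<in> mcar N" for u n w
  proof -
    obtain x where x: "x \<in> mcar M" "w = g x" using ex w by blast
    have "act N u n w = g (act M u n x)" using g(3)[OF u x(1)] x(2) by simp
    then show ?thesis using inv[OF assms(3)[OF u x(1)]] inv[OF x(1)] x(2) by simp
  qed
  ultimately show ?thesis unfolding module_iso_def by blast
qed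

lemma module_iso_trans:
  assumes "module_iso V M N" "module_iso V N L"
  shows "module_iso V M L"
proof -
  obtain g where g: "bij_betw g (mcar M) (mcar N)" "linear_on (mcar M) g"
      "\<And>u n w. u \<in> vcar V \<Longrightarrow> w \<in> mcar M \<Longrightarrow> g (act M u n w) = act N u n (g w)"
    using assms(1) unfolding module_iso_def by blast
  obtain h where h: "bij_betw h (mcar N) (mcar L)" "linear_on (mcar N) h"
      "\<And>u n w. u \<in> vcar V \<Longrightarrow> w \<in> mcar N \<Longrightarrow> h (act N u n w) = act L u n (h w)"
    using assms(2) unfolding module_iso_def by blast
  have gN: "g x \<in> mcar N" if "x \<in> mcar M" for x using g(1) that by (auto simp: bij_betw_def)
  show ?thesis unfolding module_iso_def
    by (rule exI[of _ "h \<circ> g"])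
      (use g h gN bij_betw_trans[OF g(1) h(1)] in \<open>auto simp: linear_on_def\<close>)
qed

lemma simple_action_iso:
  assumes "simple_action V N" "module_iso V M N" "vs.subspace (mcar M)"
  shows "simple_action V M"
proof -
  obtain g where g: "bij_betw g (mcar M) (mcar N)" "linear_on (mcar M) g"
      "\<And>u n w. u \<in> vcar V \<Longrightarrow> w \<in> mcar M \<Longrightarrow> g (act M u n w) = act N u n (g w)"
    using assms(2) unfolding module_iso_def by blast
  have inj: "inj_on g (mcar M)" and im: "g ` mcar M = mcar N" using g(1) by (auto simp: bij_betw_def)
  have g0: "g 0 = 0" using linear_on_0[OF g(2) assms(3)] .
  have "mcar M \<noteq> {0}" using im g0 assms(1) unfolding simple_action_def by auto
  moreover have "D = {0} \<or> D = mcar M"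
    if D: "vs.subspace D" "D \<subseteq> mcar M" "\<forall>u\<in>vcar V. \<forall>n. \<forall>w\<in>D. act M u n w \<in> D" for D
  proof -
    have sub: "vs.subspace (g ` D)"
      unfolding vs.subspace_def
    proof (intro conjI allI ballI)
      show "0 \<in> g ` D" using g0 vs.subspace_0[OF D(1)] by force
    next
      fix x y assume "x \<in> g ` D" "y \<in> g ` D"
      then obtain x' y' where "x' \<in> D" "y' \<in> D" "x = g x'" "y = g y'" by blast
      then show "x + y \<in> g ` D"
        using linear_on_add[OF g(2), of x' y'] D(2) vs.subspace_add[OF D(1), of x' y']
        by (metis image_eqI subsetD)
    next
      fix c x assume "x \<in> g ` D"
      then obtain x' where "x' \<in> D" "x = g x'" by blast
      then show "smult c x \<in> g ` D"
        using linear_on_smult[OF g(2), of x' c] D(2) vs.subspace_scale[OF D(1), of x' c]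
        by (metis image_eqI subsetD)
    qed
    have "g ` D \<subseteq> mcar N" using D(2) im by blast
    have cl: "act N u n w \<in> g ` D" if "u \<in> vcar V" "w \<in> g ` D" for u n w
    proof -
      obtain x where x: "x \<in> D" "w = g x" using \<open>w \<in> g ` D\<close> by blast
      have "act N u n w = g (act M u n x)" using g(3)[OF \<open>u \<in> vcar V\<close>] x D(2) by auto
      then show ?thesis using D(3) \<open>u \<in> vcar V\<close> x by blast
    qed
    have "g ` D = {0} \<or> g ` D = g ` mcar M"
      using simple_actionD[OF assms(1) sub \<open>g ` D \<subseteq> mcar N\<close> cl] im by simp
    then have "g ` D = g ` {0} \<or> g ` D = g ` mcar M" using g0 by simp
    moreover have "{0} \<subseteq> mcar M" using vs.subspace_0[OF assms(3)] by blast
    ultimately show ?thesis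
      using inj_on_image_eq_iff[OF inj D(2)] by blast
  qed
  ultimately show ?thesis unfolding simple_action_def by blast
qed

text \<open>
  Goursat's lemma for two simple modules: \<open>R\<close> is a submodule of \<open>M \<oplus> N\<close>, written as a relation.  Its two
  kernels and two projections are submodules of \<open>M\<close> or \<open>N\<close>.  The pair \<open>(a, b)\<close> shows that the kernels
  are proper and the projections nonzero, so \<open>R\<close> is the graph of a bijection.
\<close>

lemma simple_relation_imp_iso:
  assumes M: "vertex_action V M" "simple_action V M" and N: "vertex_action V N" "simple_action V N"
    and sub: "\<And>x y. R x y \<Longrightarrow> x \<in> mcar M \<and> y \<in> mcar N"
    and add: "\<And>x y x' y'. R x y \<Longrightarrow> R x' y' \<Longrightarrow> R (x + x') (y + y')"
    and scale: "\<And>c x y. R x y \<Longrightarrow> R (smult c x) (smult c y)"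
    and act: "\<And>u n x y. u \<in> vcar V \<Longrightarrow> R x y \<Longrightarrow> R (act M u n x) (act N u n y)"
    and ex: "R a b" "a \<noteq> 0" "b \<noteq> 0" "\<not> R a 0" "\<not> R 0 b"
  shows "module_iso V M N"
proof -
  interpret M: vertex_action V M by fact
  interpret N: vertex_action V N by fact
  have R0: "R 0 0" using scale[OF ex(1), of 0] by simp
  have kerN: "y = 0" if "R 0 y" for y
  proof -
    have "{y. R 0 y} = {0} \<or> {y. R 0 y} = mcar N"
    proof (rule simple_actionD[OF N(2)])
      show "vs.subspace {y. R 0 y}"
        using R0 add[of 0 _ 0] scale[of 0] by (auto simp: vs.subspace_def)
      show "act N u n w \<in> {y. R 0 y}" if "u \<in> vcar V" "w \<in> {y. R 0 y}" for u n w
        using act[of u 0 w n] that by simp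
    qed (use sub in auto)
    then show ?thesis using that ex sub[OF ex(1)] by auto
  qed
  have kerM: "x = 0" if "R x 0" for x
  proof -
    have "{x. R x 0} = {0} \<or> {x. R x 0} = mcar M"
    proof (rule simple_actionD[OF M(2)])
      show "vs.subspace {x. R x 0}"
        using R0 add[of _ 0 _ 0] scale[of _ 0] by (auto simp: vs.subspace_def)
      show "act M u n w \<in> {x. R x 0}" if "u \<in> vcar V" "w \<in> {x. R x 0}" for u n w
        using act[of u w 0 n] that by simp
    qed (use sub in auto)
    then show ?thesis using that ex sub[OF ex(1)] by auto
  qed
  have domM: "\<exists>y. R x y" if "x \<in> mcar M" for x
  proof -
    have "{x. \<exists>y. R x y} = {0} \<or> {x. \<exists>y. R x y} = mcar M"
    proof (rule simple_actionD[OF M(2)])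
      show "vs.subspace {x. \<exists>y. R x y}"
        unfolding vs.subspace_def using R0 add scale by blast
      show "act M u n w \<in> {x. \<exists>y. R x y}" if "u \<in> vcar V" "w \<in> {x. \<exists>y. R x y}" for u n w
        using act[of u w _ n] that by blast
    qed (use sub in auto)
    then show ?thesis using that ex by auto
  qed
  have ranN: "\<exists>x. R x y" if "y \<in> mcar N" for y
  proof -
    have "{y. \<exists>x. R x y} = {0} \<or> {y. \<exists>x. R x y} = mcar N"
    proof (rule simple_actionD[OF N(2)])
      show "vs.subspace {y. \<exists>x. R x y}"
        unfolding vs.subspace_def using R0 add scale by blast
      show "act N u n w \<in> {y. \<exists>x. R x y}" if "u \<in> vcar V" "w \<in> {y. \<exists>x. R x y}" for u n w
        using act[of u _ w n] that by blast
    qed (use sub in auto)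
    then show ?thesis using that ex by auto
  qed
  have uniq: "y = y'" if "R x y" "R x y'" for x y y'
    using add[OF that(1) scale[OF that(2), of "-1"]] kerN[of "y - y'"] by simp
  have uniq': "x = x'" if "R x y" "R x' y" for x x' y
    using add[OF that(1) scale[OF that(2), of "-1"]] kerM[of "x - x'"] by simp
  define g where "g x = (THE y. R x y)" for x
  have g: "g x = y" if "R x y" for x y
    unfolding g_def using that uniq by blast
  have Rg: "R x (g x)" if "x \<in> mcar M" for x
    using domM[OF that] g by blast
  have "bij_betw g (mcar M) (mcar N)"
    unfolding bij_betw_def inj_on_def
  proof (intro conjI ballI impI set_eqI iffI)
    show "x = y" if "x \<in> mcar M" "y \<in> mcar M" "g x = g y" for x y
      using Rg[OF that(1)] Rg[OF that(2)] that(3) uniq' by simp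
    show "y \<in> mcar N" if "y \<in> g ` mcar M" for y using that Rg sub by blast
    show "y \<in> g ` mcar M" if "y \<in> mcar N" for y
      using ranN[OF that] g sub by (metis image_eqI)
  qed
  moreover have "linear_on (mcar M) g"
    unfolding linear_on_def
    using g[OF add[OF Rg Rg]] g[OF scale[OF Rg]] by blast
  moreover have "g (act M u n w) = act N u n (g w)" if "u \<in> vcar V" "w \<in> mcar M" for u n w
    using act[OF that(1) Rg[OF that(2)]] g by blast
  ultimately show ?thesis unfolding module_iso_def by blast
qed

text \<open>
  \<open>V = P \<oplus> Q\<close> and \<open>M = A \<oplus> C\<close> are graded by the group of order two, with \<open>P\<close> and \<open>A\<close> of even degree.
\<close>

locale graded_action = vertex_action V M for V M +
  fixes P Q A C :: "vec set"
  assumes subspaces: "vs.subspace P" "vs.subspace Q" "vs.subspace A" "vs.subspace C"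
    and alg_decomp: "vcar V = {x + y | x y. x \<in> P \<and> y \<in> Q}"
    and mod_decomp: "mcar M = {x + y | x y. x \<in> A \<and> y \<in> C}"
    and disjoint: "A \<inter> C = {0}"
    and PQ: "u \<in> P \<Longrightarrow> v \<in> Q \<Longrightarrow> mode V u n v \<in> Q"
    and QQ: "u \<in> Q \<Longrightarrow> v \<in> Q \<Longrightarrow> mode V u n v \<in> P"
    and PA: "u \<in> P \<Longrightarrow> w \<in> A \<Longrightarrow> act M u n w \<in> A"
    and QA: "u \<in> Q \<Longrightarrow> w \<in> A \<Longrightarrow> act M u n w \<in> C"
    and QC: "u \<in> Q \<Longrightarrow> w \<in> C \<Longrightarrow> act M u n w \<in> A"
begin

lemma P_alg: "u \<in> P \<Longrightarrow> u \<in> vcar V"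
  using alg_decomp vs.subspace_0[OF subspaces(2)] by force

lemma Q_alg: "u \<in> Q \<Longrightarrow> u \<in> vcar V"
  using alg_decomp vs.subspace_0[OF subspaces(1)] by force

lemma A_mod: "w \<in> A \<Longrightarrow> w \<in> mcar M"
  using mod_decomp vs.subspace_0[OF subspaces(4)] by force

lemma C_mod: "w \<in> C \<Longrightarrow> w \<in> mcar M"
  using mod_decomp vs.subspace_0[OF subspaces(3)] by force

end

text \<open>
  The odd part \<open>{(\<Sum> u\<^sub>n a, \<Sum> u\<^sub>n \<phi>(a)) | u \<in> Q, a \<in> A}\<close> of the submodule of \<open>M \<oplus> N\<close> generated by the
  graph of \<open>\<phi>\<close>.
\<close>

inductive odd_relation :: "vmod \<Rightarrow> vmod \<Rightarrow> vec set \<Rightarrow> vec set \<Rightarrow> (vec \<Rightarrow> vec) \<Rightarrow> vec \<Rightarrow> vec \<Rightarrow> bool"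
  for M N Q A \<phi> where
  zero: "odd_relation M N Q A \<phi> 0 0"
| step: "odd_relation M N Q A \<phi> x y \<Longrightarrow> u \<in> Q \<Longrightarrow> a \<in> A \<Longrightarrow>
    odd_relation M N Q A \<phi> (x + act M u n a) (y + act N u n (\<phi> a))"

locale even_intertwined = M: graded_action V M P Q A C + N: graded_action V N P Q A' C'
  for V M N P Q A C A' C' +
  fixes \<phi> :: "vec \<Rightarrow> vec"
  assumes bij: "bij_betw \<phi> A A'" and lin: "linear_on A \<phi>"
    and hom: "u \<in> P \<Longrightarrow> a \<in> A \<Longrightarrow> \<phi> (act M u n a) = act N u n (\<phi> a)"
begin

abbreviation "odd_rel \<equiv> odd_relation M N Q A \<phi>"

lemma phi_A: "a \<in> A \<Longrightarrow> \<phi> a \<in> A'"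
  using bij by (auto simp: bij_betw_def)

lemma phi_0: "\<phi> 0 = 0"
  using linear_on_0[OF lin M.subspaces(3)] .

lemma odd_rel_single: "u \<in> Q \<Longrightarrow> a \<in> A \<Longrightarrow> odd_rel (act M u n a) (act N u n (\<phi> a))"
  using odd_relation.step[OF odd_relation.zero] by fastforce

lemma odd_rel_closed: "odd_rel x y \<Longrightarrow> x \<in> C \<and> y \<in> C'"
proof (induction rule: odd_relation.induct)
  case zero
  then show ?case using vs.subspace_0 M.subspaces N.subspaces by blast
next
  case (step x y u a n)
  then show ?case
    using vs.subspace_add[OF M.subspaces(4)] vs.subspace_add[OF N.subspaces(4)] M.QA N.QA phi_A by blast
qed

lemma odd_rel_add: "odd_rel x' y' \<Longrightarrow> odd_rel x y \<Longrightarrow> odd_rel (x + x') (y + y')"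
proof (induction rule: odd_relation.induct)
  case zero
  then show ?case by simp
next
  case (step x' y' u a n)
  then show ?case using odd_relation.step[of M N Q A \<phi> "x + x'" "y + y'" u a n] by (simp add: add.assoc)
qed

lemma odd_rel_scale: "odd_rel x y \<Longrightarrow> odd_rel (smult c x) (smult c y)"
proof (induction rule: odd_relation.induct)
  case zero
  then show ?case by (simp add: odd_relation.zero)
next
  case (step x y u a n)
  have "smult c (act M u n a) = act M u n (smult c a)"
    using linear_on_smult[OF M.linear2[OF M.Q_alg[OF step(2)]] M.A_mod[OF step(3)]] by simp
  moreover have "smult c (act N u n (\<phi> a)) = act N u n (\<phi> (smult c a))"
    using linear_on_smult[OF N.linear2[OF N.Q_alg[OF step(2)]] N.A_mod[OF phi_A[OF step(3)]]]
      linear_on_smult[OF lin step(3)] by simp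
  moreover have "smult c a \<in> A" using vs.subspace_scale[OF M.subspaces(3) step(3)] .
  ultimately show ?case
    using odd_relation.step[OF step(4,2), of "smult c a" n] by (simp add: vs.scale_right_distrib)
qed

lemma odd_rel_sum:
  assumes "finite I" "\<And>i. i \<in> I \<Longrightarrow> odd_rel (f i) (g i)"
  shows "odd_rel (\<Sum>i\<in>I. f i) (\<Sum>i\<in>I. g i)"
  using assms
proof (induction I rule: finite_induct)
  case empty
  then show ?case by (simp add: odd_relation.zero)
next
  case (insert i I)
  have "odd_rel (sum f I) (sum g I)" using insert by blast
  then show ?case using insert odd_rel_add[of "sum f I" "sum g I" "f i" "g i"] by simp
qed

text \<open>
  Commuting \<open>v\<close> past \<open>u\<close> produces only modes of \<open>v\<^sub>i u \<in> Q\<close>, and \<open>\<phi>\<close> commutes with \<open>v\<close>.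
\<close>

lemma odd_rel_P:
  assumes "odd_rel x y" "v \<in> P"
  shows "odd_rel (act M v m x) (act N v m y)"
  using assms(1)
proof (induction rule: odd_relation.induct)
  case zero
  then show ?case using assms(2) by (simp add: M.P_alg odd_relation.zero)
next
  case (step x y u a n)
  note v = M.P_alg[OF assms(2)] and u = M.Q_alg[OF step(2)] and a = M.A_mod[OF step(3)]
    and b = N.A_mod[OF phi_A[OF step(3)]]
  obtain K1 where K1: "\<And>K. K \<ge> K1 \<Longrightarrow> act M v m (act M u n a) = act M u n (act M v m a) +
     (\<Sum>i<K. smult ((of_int m) gchoose i) (act M (mode V v (int i) u) (m + n - int i) a))"
    using M.commutator_formula[OF v u a] by blast
  obtain K2 where K2: "\<And>K. K \<ge> K2 \<Longrightarrow> act N v m (act N u n (\<phi> a)) = act N u n (act N v m (\<phi> a)) +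
     (\<Sum>i<K. smult ((of_int m) gchoose i) (act N (mode V v (int i) u) (m + n - int i) (\<phi> a)))"
    using N.commutator_formula[OF v u b] by blast
  define K where "K = max K1 K2"
  have 1: "odd_rel (act M u n (act M v m a)) (act N u n (act N v m (\<phi> a)))"
    using odd_rel_single[OF step(2) M.PA[OF assms(2) step(3)]] hom[OF assms(2) step(3)] by simp
  have 2: "odd_rel (\<Sum>i<K. smult ((of_int m) gchoose i) (act M (mode V v (int i) u) (m + n - int i) a))
     (\<Sum>i<K. smult ((of_int m) gchoose i) (act N (mode V v (int i) u) (m + n - int i) (\<phi> a)))"
    by (rule odd_rel_sum[OF finite_lessThan odd_rel_scale[OF odd_rel_single[OF M.PQ[OF assms(2) step(2)] step(3)]]])
  have 3: "odd_rel (act M v m (act M u n a)) (act N v m (act N u n (\<phi> a)))"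
    using odd_rel_add[OF 2 1] K1[of K] K2[of K] by (simp add: K_def)
  have xy: "x \<in> mcar M" "y \<in> mcar N" using odd_rel_closed[OF step(1)] M.C_mod N.C_mod by auto
  have "act M v m (x + act M u n a) = act M v m x + act M v m (act M u n a)"
    using linear_on_add[OF M.linear2[OF v]] xy M.closed[OF u a] by blast
  moreover have "act N v m (y + act N u n (\<phi> a)) = act N v m y + act N v m (act N u n (\<phi> a))"
    using linear_on_add[OF N.linear2[OF v]] xy N.closed[OF u b] by blast
  ultimately show ?case using odd_rel_add[OF 3 step(4)] by simp
qed

lemma phi_sum:
  assumes "\<And>i. i \<in> I \<Longrightarrow> f i \<in> A \<and> \<phi> (f i) = g i"
  shows "(\<Sum>i\<in>I. f i) \<in> A \<and> \<phi> (\<Sum>i\<in>I. f i) = (\<Sum>i\<in>I. g i)"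
proof
  show "(\<Sum>i\<in>I. f i) \<in> A" by (rule vs.subspace_sum[OF M.subspaces(3)]) (use assms in blast)
  have "\<phi> (\<Sum>i\<in>I. f i) = (\<Sum>i\<in>I. \<phi> (f i))"
    by (rule linear_on_sum[OF lin M.subspaces(3)]) (use assms in blast)
  also have "\<dots> = (\<Sum>i\<in>I. g i)" by (rule sum.cong) (use assms in blast)+
  finally show "\<phi> (\<Sum>i\<in>I. f i) = (\<Sum>i\<in>I. g i)" .
qed

text \<open>
  Two odd modes rewrite into modes of even vectors \<open>u\<^sub>i v\<close>, with which \<open>\<phi>\<close> commutes.  The correction
  terms have a larger index \<open>q\<close> and vanish on both modules once \<open>q \<ge> L\<close>; hence the induction on
  \<open>L - q\<close>.
\<close>

lemma hom_QQ:
  assumes u: "u \<in> Q" and v: "v \<in> Q" and a: "a \<in> A"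
  shows "\<phi> (act M u p (act M v q a)) = act N u p (act N v q (\<phi> a))"
proof -
  note u' = M.Q_alg[OF u] and v' = M.Q_alg[OF v] and a' = M.A_mod[OF a] and b' = N.A_mod[OF phi_A[OF a]]
  obtain L1 where L1: "\<And>q. q \<ge> L1 \<Longrightarrow> act M v q a = 0" using M.trunc[OF v' a'] by blast
  obtain L2 where L2: "\<And>q. q \<ge> L2 \<Longrightarrow> act N v q (\<phi> a) = 0" using N.trunc[OF v' b'] by blast
  define L where "L = max L1 L2"
  show ?thesis
  proof (induction "nat (L - q)" arbitrary: p q rule: less_induct)
    case less
    show ?case
    proof (cases "q \<ge> L")
      case True
      then show ?thesis using L1[of q] L2[of q] M.act_zero2[OF u'] N.act_zero2[OF u'] phi_0 by (simp add: L_def)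
    next
      case False
      obtain N1 where N1: "\<forall>m\<ge>N1. \<exists>K. \<forall>K'\<ge>K. act M u p (act M v q a)
        = (\<Sum>i<K'. smult ((of_int m) gchoose i)
             (act M (mode V u (p - m + int i) v) (m + q - int i) a))
          - (\<Sum>i\<in>{1..<K'}. smult ((-1) ^ i * ((of_int (p - m)) gchoose i))
               (act M u (p - int i) (act M v (q + int i) a)))"
        using M.product_formula[OF u' v' a'] by blast
      obtain N2 where N2: "\<forall>m\<ge>N2. \<exists>K. \<forall>K'\<ge>K. act N u p (act N v q (\<phi> a))
        = (\<Sum>i<K'. smult ((of_int m) gchoose i)
             (act N (mode V u (p - m + int i) v) (m + q - int i) (\<phi> a)))
          - (\<Sum>i\<in>{1..<K'}. smult ((-1) ^ i * ((of_int (p - m)) gchoose i))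
               (act N u (p - int i) (act N v (q + int i) (\<phi> a))))"
        using N.product_formula[OF u' v' b'] by blast
      \<comment> \<open>one choice of \<open>m\<close> and \<open>K\<close> for both modules makes the two expansions match term by term\<close>
      define m where "m = max N1 N2"
      obtain K1 where K1: "\<forall>K'\<ge>K1. act M u p (act M v q a)
        = (\<Sum>i<K'. smult ((of_int m) gchoose i)
             (act M (mode V u (p - m + int i) v) (m + q - int i) a))
          - (\<Sum>i\<in>{1..<K'}. smult ((-1) ^ i * ((of_int (p - m)) gchoose i))
               (act M u (p - int i) (act M v (q + int i) a)))"
        using N1 m_def by (meson max.cobounded1)
      obtain K2 where K2: "\<forall>K'\<ge>K2. act N u p (act N v q (\<phi> a))
        = (\<Sum>i<K'. smult ((of_int m) gchoose i)
             (act N (mode V u (p - m + int i) v) (m + q - int i) (\<phi> a)))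
          - (\<Sum>i\<in>{1..<K'}. smult ((-1) ^ i * ((of_int (p - m)) gchoose i))
               (act N u (p - int i) (act N v (q + int i) (\<phi> a))))"
        using N2 m_def by (meson max.cobounded2)
      define K where "K = max K1 K2"
      let ?S = "\<Sum>i<K. smult ((of_int m) gchoose i)
             (act M (mode V u (p - m + int i) v) (m + q - int i) a)"
      let ?T = "\<Sum>i\<in>{1..<K}. smult ((-1) ^ i * ((of_int (p - m)) gchoose i))
               (act M u (p - int i) (act M v (q + int i) a))"
      let ?S' = "\<Sum>i<K. smult ((of_int m) gchoose i)
             (act N (mode V u (p - m + int i) v) (m + q - int i) (\<phi> a))"
      let ?T' = "\<Sum>i\<in>{1..<K}. smult ((-1) ^ i * ((of_int (p - m)) gchoose i))
               (act N u (p - int i) (act N v (q + int i) (\<phi> a)))"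
      have eqs: "act M u p (act M v q a) = ?S - ?T" "act N u p (act N v q (\<phi> a)) = ?S' - ?T'"
        using K1 K2 by (simp_all add: K_def)
      have S: "?S \<in> A \<and> \<phi> ?S = ?S'"
      proof (rule phi_sum)
        fix i
        have P: "mode V u (p - m + int i) v \<in> P" by (rule M.QQ[OF u v])
        show "smult ((of_int m) gchoose i) (act M (mode V u (p - m + int i) v) (m + q - int i) a) \<in> A \<and>
          \<phi> (smult ((of_int m) gchoose i) (act M (mode V u (p - m + int i) v) (m + q - int i) a)) =
          smult ((of_int m) gchoose i) (act N (mode V u (p - m + int i) v) (m + q - int i) (\<phi> a))"
          using vs.subspace_scale[OF M.subspaces(3) M.PA[OF P a]]
            linear_on_smult[OF lin M.PA[OF P a]] hom[OF P a] by simp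
      qed
      have T: "?T \<in> A \<and> \<phi> ?T = ?T'"
      proof (rule phi_sum)
        fix i assume i: "i \<in> {1..<K}"
        have inA: "act M u (p - int i) (act M v (q + int i) a) \<in> A"
          by (rule M.QC[OF u M.QA[OF v a]])
        have "\<phi> (act M u (p - int i) (act M v (q + int i) a)) = act N u (p - int i) (act N v (q + int i) (\<phi> a))"
          by (rule less) (use i False in auto)
        then show "smult ((-1) ^ i * ((of_int (p - m)) gchoose i)) (act M u (p - int i) (act M v (q + int i) a)) \<in> A \<and>
          \<phi> (smult ((-1) ^ i * ((of_int (p - m)) gchoose i)) (act M u (p - int i) (act M v (q + int i) a))) =
          smult ((-1) ^ i * ((of_int (p - m)) gchoose i)) (act N u (p - int i) (act N v (q + int i) (\<phi> a)))"
          using vs.subspace_scale[OF M.subspaces(3) inA] linear_on_smult[OF lin inA] by simp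
      qed
      show ?thesis unfolding eqs
        using linear_on_diff[OF lin M.subspaces(3)] S T by simp
    qed
  qed
qed

lemma odd_rel_Q:
  assumes "odd_rel x y" "v \<in> Q"
  shows "\<phi> (act M v m x) = act N v m y"
  using assms(1)
proof (induction rule: odd_relation.induct)
  case zero
  then show ?case using assms(2) by (simp add: M.Q_alg phi_0)
next
  case (step x y u a n)
  note v = M.Q_alg[OF assms(2)] and u = M.Q_alg[OF step(2)] and a = M.A_mod[OF step(3)]
    and b = N.A_mod[OF phi_A[OF step(3)]]
  note xy = odd_rel_closed[OF step(1)]
  have "act M v m (x + act M u n a) = act M v m x + act M v m (act M u n a)"
    using linear_on_add[OF M.linear2[OF v]] xy M.C_mod M.closed[OF u a] by blast
  moreover have "act N v m (y + act N u n (\<phi> a)) = act N v m y + act N v m (act N u n (\<phi> a))"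
    using linear_on_add[OF N.linear2[OF v]] xy N.C_mod N.closed[OF u b] by blast
  moreover have "act M v m x \<in> A" "act M v m (act M u n a) \<in> A"
    using M.QC M.QA assms(2) xy step by blast+
  ultimately show ?case using linear_on_add[OF lin] step(4) hom_QQ[OF assms(2) step(2,3)] by simp
qed

text \<open>
  The generated submodule is the graph of \<open>\<phi>\<close> plus the odd relation.  Since the odd relation lives in
  \<open>C \<oplus> C'\<close>, the submodule contains neither \<open>(a, 0)\<close> nor \<open>(0, \<phi>(a))\<close> for \<open>a \<noteq> 0\<close> in \<open>A\<close>, and the simplicity of
  both modules does the rest.
\<close>

lemma extends:
  assumes simple: "simple_action V M" "simple_action V N" and "A \<noteq> {0}"
  shows "module_iso V M N"
proof -
  define R where "R z w \<longleftrightarrow> (\<exists>a\<in>A. \<exists>x y. odd_rel x y \<and> z = a + x \<and> w = \<phi> a + y)" for z w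
  have RI: "R (a + x) (\<phi> a + y)" if "a \<in> A" "odd_rel x y" for a x y
    unfolding R_def using that by blast
  obtain a where a: "a \<in> A" "a \<noteq> 0"
    using \<open>A \<noteq> {0}\<close> vs.subspace_0[OF M.subspaces(3)] by blast
  have inj: "c = 0" if "c \<in> A" "\<phi> c = 0" for c
    using bij that phi_0 vs.subspace_0[OF M.subspaces(3)]
    by (metis bij_betw_inv_into_left)
  have Raa: "R a (\<phi> a)" using RI[OF a(1) odd_relation.zero] by simp
  have split0: "c = 0 \<and> x = 0" if "c \<in> A" "x \<in> C" "c + x = 0" for c x
  proof -
    have "c = - x" using that(3) by (simp add: eq_neg_iff_add_eq_0)
    then have "c \<in> A \<inter> C" using that vs.subspace_neg[OF M.subspaces(4)] by simp
    then show ?thesis using M.disjoint \<open>c = - x\<close> by simp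
  qed
  have split0': "c = 0 \<and> x = 0" if "c \<in> A'" "x \<in> C'" "c + x = 0" for c x
  proof -
    have "c = - x" using that(3) by (simp add: eq_neg_iff_add_eq_0)
    then have "c \<in> A' \<inter> C'" using that vs.subspace_neg[OF N.subspaces(4)] by simp
    then show ?thesis using N.disjoint \<open>c = - x\<close> by simp
  qed
  show ?thesis
  proof (rule simple_relation_imp_iso[where R = R, OF M.vertex_action_axioms simple(1) N.vertex_action_axioms simple(2)])
    show "x \<in> mcar M \<and> y \<in> mcar N" if "R x y" for x y
      using that odd_rel_closed phi_A unfolding R_def M.mod_decomp N.mod_decomp by blast
    show "R (x + x') (y + y')" if xy: "R x y" "R x' y'" for x y x' y'
    proof -
      obtain c z w where 1: "c \<in> A" "odd_rel z w" "x = c + z" "y = \<phi> c + w"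
        using xy(1) unfolding R_def by blast
      obtain c' z' w' where 2: "c' \<in> A" "odd_rel z' w'" "x' = c' + z'" "y' = \<phi> c' + w'"
        using xy(2) unfolding R_def by blast
      have "R ((c + c') + (z + z')) (\<phi> (c + c') + (w + w'))"
        by (rule RI) (use 1 2 odd_rel_add vs.subspace_add[OF M.subspaces(3)] in auto)
      then show ?thesis using 1 2 linear_on_add[OF lin 1(1) 2(1)] by (simp add: algebra_simps)
    qed
    show "R (smult c x) (smult c y)" if xy: "R x y" for c x y
    proof -
      obtain d z w where 1: "d \<in> A" "odd_rel z w" "x = d + z" "y = \<phi> d + w"
        using xy unfolding R_def by blast
      have "R (smult c d + smult c z) (\<phi> (smult c d) + smult c w)"
        by (rule RI) (use 1 odd_rel_scale vs.subspace_scale[OF M.subspaces(3)] in auto)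
      then show ?thesis using 1 linear_on_smult[OF lin 1(1)] by (simp add: vs.scale_right_distrib)
    qed
    show "R (act M u n x) (act N u n y)" if u: "u \<in> vcar V" and xy: "R x y" for u n x y
    proof -
      obtain c z w where 1: "c \<in> A" "odd_rel z w" "x = c + z" "y = \<phi> c + w"
        using xy unfolding R_def by blast
      obtain p q where 2: "p \<in> P" "q \<in> Q" "u = p + q" using u M.alg_decomp by blast
      note zw = odd_rel_closed[OF 1(2)]
      have xyM: "x \<in> mcar M" "y \<in> mcar N" "c \<in> mcar M" "z \<in> mcar M" "\<phi> c \<in> mcar N" "w \<in> mcar N"
        using 1 M.C_mod[of z] N.C_mod[of w] M.A_mod[OF 1(1)] N.A_mod[OF phi_A[OF 1(1)]] zw
          vs.subspace_add[OF M.mod_subspace, of c z] vs.subspace_add[OF N.mod_subspace, of "\<phi> c" w]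
        by simp_all
      note pq = M.P_alg[OF 2(1)] M.Q_alg[OF 2(2)]
      have eM: "act M u n x = (act M p n c + act M q n z) + (act M p n z + act M q n c)"
        using linear_on_add[OF M.linear1[OF xyM(1)] pq] linear_on_add[OF M.linear2[OF pq(1)] xyM(3,4)]
          linear_on_add[OF M.linear2[OF pq(2)] xyM(3,4)] 2(3) 1(3) by (simp add: algebra_simps)
      have eN: "act N u n y = (act N p n (\<phi> c) + act N q n w) + (act N p n w + act N q n (\<phi> c))"
        using linear_on_add[OF N.linear1[OF xyM(2)] pq] linear_on_add[OF N.linear2[OF pq(1)] xyM(5,6)]
          linear_on_add[OF N.linear2[OF pq(2)] xyM(5,6)] 2(3) 1(4) by (simp add: algebra_simps)
      have inA: "act M p n c \<in> A" "act M q n z \<in> A" using M.PA M.QC 1 2 zw by auto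
      have "\<phi> (act M p n c + act M q n z) = act N p n (\<phi> c) + act N q n w"
        using linear_on_add[OF lin inA] hom[OF 2(1) 1(1)] odd_rel_Q[OF 1(2) 2(2)] by simp
      moreover have "odd_rel (act M p n z + act M q n c) (act N p n w + act N q n (\<phi> c))"
        using odd_rel_add[OF odd_rel_single[OF 2(2) 1(1)] odd_rel_P[OF 1(2) 2(1)]] .
      ultimately show ?thesis
        using RI[of "act M p n c + act M q n z"] vs.subspace_add[OF M.subspaces(3) inA] eM eN by metis
    qed
    show "R a (\<phi> a)" "a \<noteq> 0" by fact+
    show "\<phi> a \<noteq> 0" using inj a by blast
    show "\<not> R a 0"
    proof
      assume "R a 0"
      then obtain c x y where c: "c \<in> A" "odd_rel x y" "a = c + x" "0 = \<phi> c + y"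
        unfolding R_def by blast
      then have "c = 0" using split0'[of "\<phi> c" y] phi_A odd_rel_closed inj by metis
      then have "a \<in> C" using c odd_rel_closed by simp
      then show False using a M.disjoint by blast
    qed
    show "\<not> R 0 (\<phi> a)"
    proof
      assume "R 0 (\<phi> a)"
      then obtain c x y where c: "c \<in> A" "odd_rel x y" "0 = c + x" "\<phi> a = \<phi> c + y"
        unfolding R_def by blast
      then have "c = 0" using split0[of c x] odd_rel_closed by metis
      then have "\<phi> a \<in> C'" using c odd_rel_closed phi_0 by simp
      then show False using \<open>\<phi> a \<noteq> 0\<close> N.disjoint phi_A[OF a(1)] by blast
    qed
  qed
qed

end

section \<open>Intertwining operators and vanishing fusion rules\<close>

lemma is_moduleD:
  assumes "is_module V M"
  shows "vs.subspace (mcar M)" "bilinear_into (vcar V) (mcar M) (mcar M) (act M)"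
    "\<forall>u\<in>vcar V. \<forall>w\<in>mcar M. \<exists>N. \<forall>n\<ge>N. act M u n w = 0"
    "\<forall>u\<in>vcar V. \<forall>v\<in>vcar V. \<forall>w\<in>mcar M. jacobi (mode V) (act M) (act M) (act M) u v w"
    "\<forall>u\<in>vcar V. \<forall>w\<in>mcar M. \<forall>n.
       act M (Lop V (adjoint_mod V) (-1) u) n w = smult (- of_int n) (act M u (n - 1) w)"
  using assms unfolding is_module_def by - ((elim conjE, assumption)+)

lemma is_module_imp_vertex_action:
  assumes V: "is_voa V" and M: "is_module V M"
  shows "vertex_action V M"
proof
  have ad: "is_module V (adjoint_mod V)" using V by (simp add: is_voa_def)
  note ad = is_moduleD[OF ad, unfolded adjoint_mod_def, simplified] and M = is_moduleD[OF M]
  show "vs.subspace (vcar V)" by (fact ad)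
  have bil: "bilinear_into (vcar V) (vcar V) (vcar V) (mode V)"
    by (fact ad)
  show "mode V u n v \<in> vcar V" if "u \<in> vcar V" "v \<in> vcar V" for u n v
    using bil that by (simp add: bilinear_into_def)
  show "\<exists>N. \<forall>n\<ge>N. mode V u n v = 0" if "u \<in> vcar V" "v \<in> vcar V" for u v
    using ad(3) that by blast
  show "vs.subspace (mcar M)" "bilinear_into (vcar V) (mcar M) (mcar M) (act M)"
    by (fact M)+
  show "\<exists>N. \<forall>n\<ge>N. act M u n w = 0" if "u \<in> vcar V" "w \<in> mcar M" for u w
    using M(3) that by blast
  show "jacobi (mode V) (act M) (act M) (act M) u v w"
    if "u \<in> vcar V" "v \<in> vcar V" "w \<in> mcar M" for u v w
    using M(4) that by blast
qed

lemma linear_on_Sum_any: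
  fixes f :: "nat \<Rightarrow> 'i \<Rightarrow>\<^sub>0 complex"
  assumes "linear_on S q" "vs.subspace S" "\<And>i. f i \<in> S" "\<exists>K. \<forall>i\<ge>K. f i = 0"
  shows "Sum_any (\<lambda>i. q (f i)) = q (Sum_any f)"
proof -
  obtain K where K: "\<And>i. i \<ge> K \<Longrightarrow> f i = 0" using assms(4) by blast
  have "Sum_any f = (\<Sum>i<K. f i)" by (rule Sum_any_lessThan) (rule K)
  moreover have "Sum_any (\<lambda>i. q (f i)) = (\<Sum>i<K. q (f i))"
    by (rule Sum_any_lessThan) (simp add: K linear_on_0[OF assms(1,2)])
  ultimately show ?thesis using linear_on_sum[OF assms(1,2), of "{..<K}" f] assms(3) by simp
qed

text \<open>
  The module action of \<open>V\<close> on \<open>N\<close>, read as an operator from \<open>R1\<close> and \<open>R2\<close> through \<open>p1\<close> and \<open>p2\<close>, and pushed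
  forward by \<open>q\<close>.  The actions have integral modes, so all components with a nonintegral index are
  \<open>0\<close>.
\<close>

definition pulled_back :: "vmod \<Rightarrow> vmod \<Rightarrow> vmod \<Rightarrow> (vec \<Rightarrow> vec) \<Rightarrow> (vec \<Rightarrow> vec) \<Rightarrow> (vec \<Rightarrow> vec) \<Rightarrow>
    vec \<Rightarrow> complex \<Rightarrow> vec \<Rightarrow> vec" where
  "pulled_back N R1 R2 p1 p2 q w1 n w2 =
     (if w1 \<in> mcar R1 \<and> w2 \<in> mcar R2 \<and> n \<in> \<int> then q (act N (p1 w1) \<lfloor>Re n\<rfloor> (p2 w2)) else 0)"

text \<open>
  The intertwiner axioms are those of the module \<open>N\<close>, transported by the linear maps \<open>p1\<close>, \<open>p2\<close>, \<open>q\<close>, which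
  commute with the subalgebra \<open>P\<close>.  For a nonintegral index all terms vanish.
\<close>

lemma pulled_back_intertwiner:
  assumes N: "vertex_action V N" and P: "P \<subseteq> vcar V" and conf: "conf V \<in> P"
    and deriv: "\<And>u w n. u \<in> vcar V \<Longrightarrow> w \<in> mcar N \<Longrightarrow>
        act N (mode V (conf V) 0 u) n w = smult (- of_int n) (act N u (n - 1) w)"
    and R: "is_module (V\<lparr>vcar := P\<rparr>) R1" "is_module (V\<lparr>vcar := P\<rparr>) R2" "is_module (V\<lparr>vcar := P\<rparr>) R3"
    and p1: "linear_on (mcar R1) p1" "\<And>x. x \<in> mcar R1 \<Longrightarrow> p1 x \<in> vcar V"
      "\<And>u n x. u \<in> P \<Longrightarrow> x \<in> mcar R1 \<Longrightarrow> p1 (act R1 u n x) = mode V u n (p1 x)"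
    and p2: "linear_on (mcar R2) p2" "\<And>x. x \<in> mcar R2 \<Longrightarrow> p2 x \<in> mcar N"
      "\<And>u n x. u \<in> P \<Longrightarrow> x \<in> mcar R2 \<Longrightarrow> p2 (act R2 u n x) = act N u n (p2 x)"
    and q: "linear_on (mcar N) q" "\<And>x. x \<in> mcar N \<Longrightarrow> q x \<in> mcar R3"
      "\<And>u n x. u \<in> P \<Longrightarrow> x \<in> mcar N \<Longrightarrow> q (act N u n x) = act R3 u n (q x)"
  shows "pulled_back N R1 R2 p1 p2 q \<in> intertwiners (V\<lparr>vcar := P\<rparr>) R1 R2 R3"
proof -
  interpret N: vertex_action V N by fact
  define I where "I = pulled_back N R1 R2 p1 p2 q"
  have I: "I w1 (of_int n) w2 = q (act N (p1 w1) n (p2 w2))"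
    if "w1 \<in> mcar R1" "w2 \<in> mcar R2" for w1 w2 n
    using that by (simp add: I_def pulled_back_def)
  have I0: "I w1 n w2 = 0" if "n \<notin> \<int>" for w1 w2 n
    using that by (simp add: I_def pulled_back_def)
  note sub = vs.subspace_add vs.subspace_scale
  have subR: "vs.subspace (mcar R1)" "vs.subspace (mcar R2)" "vs.subspace (mcar R3)"
    using R[THEN is_moduleD(1)] by auto
  have cl: "act R1 u n x \<in> mcar R1" if "u \<in> P" "x \<in> mcar R1" for u n x
    using is_moduleD(2)[OF R(1)] that by (simp add: bilinear_into_def)
  have cl2: "act R2 u n x \<in> mcar R2" if "u \<in> P" "x \<in> mcar R2" for u n x
    using is_moduleD(2)[OF R(2)] that by (simp add: bilinear_into_def)
  have lin3: "linear_on (mcar R3) (act R3 u n)" if "u \<in> P" for u n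
    using is_moduleD(2)[OF R(3)] that by (simp add: bilinear_into_def)
  have tr1: "\<exists>N. \<forall>n\<ge>N. act R1 u n x = 0" if "u \<in> P" "x \<in> mcar R1" for u x
    using is_moduleD(3)[OF R(1)] that by simp
  have q0: "q 0 = 0" using linear_on_0[OF q(1) N.mod_subspace] .
  have "\<forall>w1 n w2. w1 \<notin> mcar R1 \<or> w2 \<notin> mcar R2 \<longrightarrow> I w1 n w2 = 0"
    by (auto simp: I_def pulled_back_def)
  moreover have "bilinear_into (mcar R1) (mcar R2) (mcar R3) I"
    unfolding bilinear_into_def linear_on_def
  proof (intro conjI ballI allI)
    fix u n w assume uw: "u \<in> mcar R1" "w \<in> mcar R2"
    show "I u n w \<in> mcar R3"
      using uw p1(2) p2(2) q(2) N.closed vs.subspace_0[OF subR(3)] by (simp add: I_def pulled_back_def)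
  next
    fix u n x y assume *: "u \<in> mcar R1" "x \<in> mcar R2" "y \<in> mcar R2"
    show "I u n (x + y) = I u n x + I u n y"
      using * sub(1)[OF subR(2) *(2,3)] linear_on_add[OF p2(1) *(2,3)]
        linear_on_add[OF N.linear2[OF p1(2)[OF *(1)]] p2(2)[OF *(2)] p2(2)[OF *(3)]]
        linear_on_add[OF q(1)] N.closed p1(2) p2(2)
      by (simp add: I_def pulled_back_def)
  next
    fix u n c x assume *: "u \<in> mcar R1" "x \<in> mcar R2"
    show "I u n (smult c x) = smult c (I u n x)"
      using * sub(2)[OF subR(2) *(2)] linear_on_smult[OF p2(1) *(2)]
        linear_on_smult[OF N.linear2[OF p1(2)[OF *(1)]] p2(2)[OF *(2)]]
        linear_on_smult[OF q(1)] N.closed p1(2) p2(2)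
      by (simp add: I_def pulled_back_def)
  next
    fix w n x y assume *: "w \<in> mcar R2" "x \<in> mcar R1" "y \<in> mcar R1"
    show "I (x + y) n w = I x n w + I y n w"
      using * sub(1)[OF subR(1) *(2,3)] linear_on_add[OF p1(1) *(2,3)]
        linear_on_add[OF N.linear1[OF p2(2)[OF *(1)]] p1(2)[OF *(2)] p1(2)[OF *(3)]]
        linear_on_add[OF q(1)] N.closed p1(2) p2(2)
      by (simp add: I_def pulled_back_def)
  next
    fix w n c x assume *: "w \<in> mcar R2" "x \<in> mcar R1"
    show "I (smult c x) n w = smult c (I x n w)"
      using * sub(2)[OF subR(1) *(2)] linear_on_smult[OF p1(1) *(2)]
        linear_on_smult[OF N.linear1[OF p2(2)[OF *(1)]] p1(2)[OF *(2)]]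
        linear_on_smult[OF q(1)] N.closed p1(2) p2(2)
      by (simp add: I_def pulled_back_def)
  qed
  moreover have "\<exists>K::nat. \<forall>m\<ge>K. I w1 (n + of_nat m) w2 = 0"
    if w: "w1 \<in> mcar R1" "w2 \<in> mcar R2" for w1 w2 n
  proof (cases "n \<in> \<int>")
    case True
    then obtain k where k: "n = of_int k" by (auto elim: Ints_cases)
    obtain K where K: "\<forall>i\<ge>K. act N (p1 w1) (k + int i) (p2 w2) = 0"
      using eventually_zero_add[OF N.trunc[OF p1(2)[OF w(1)] p2(2)[OF w(2)]], of k] by blast
    have "I w1 (n + of_nat m) w2 = q (act N (p1 w1) (k + int m) (p2 w2))" for m
      using I[OF w, of "k + int m"] k by simp
    then show ?thesis using K q0 by (intro exI[of _ K]) simp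
  next
    case False
    then have "n + of_nat m \<notin> \<int>" for m using Ints_diff[of "n + of_nat m" "of_nat m"] by auto
    then show ?thesis using I0 by blast
  qed
  moreover have "jacobi (act R1) (act R2) (act R3) I u w1 w2"
    if u: "u \<in> P" and w: "w1 \<in> mcar R1" "w2 \<in> mcar R2" for u w1 w2
    unfolding jacobi_def
  proof (intro allI)
    fix l m :: int and n :: complex
    show "Sum_any (\<lambda>i::nat. smult ((of_int m :: complex) gchoose i)
        (I (act R1 u (l + int i) w1) (of_int m + n - of_nat i) w2)) =
     Sum_any (\<lambda>i::nat. smult ((-1) ^ i * ((of_int l :: complex) gchoose i))
        (act R3 u (l + m - int i) (I w1 (n + of_nat i) w2)
         - smult ((-1) powi l) (I w1 (of_int l + n - of_nat i) (act R2 u (m + int i) w2))))"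
    proof (cases "n \<in> \<int>")
      case True
      then obtain k where k: "n = of_int k" by (auto elim: Ints_cases)
      have u': "u \<in> vcar V" and a: "p1 w1 \<in> vcar V" and b: "p2 w2 \<in> mcar N"
        using u P p1(2) p2(2) w by auto
      let ?f = "\<lambda>i. smult ((of_int m :: complex) gchoose i)
          (act N (mode V u (l + int i) (p1 w1)) (m + k - int i) (p2 w2))"
      let ?g = "\<lambda>i. smult ((-1) ^ i * ((of_int l :: complex) gchoose i))
        (act N u (l + m - int i) (act N (p1 w1) (k + int i) (p2 w2))
         - smult ((-1) powi l) (act N (p1 w1) (l + k - int i) (act N u (m + int i) (p2 w2))))"
      have fN: "?f i \<in> mcar N" for i
        by (intro sub(2)[OF N.mod_subspace] N.closed N.alg_closed u' a b)
      have gN: "?g i \<in> mcar N" for i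
        by (intro sub(2)[OF N.mod_subspace] vs.subspace_diff[OF N.mod_subspace] N.closed u' a b)
      obtain K0 where K0: "\<forall>i\<ge>K0. mode V u (l + int i) (p1 w1) = 0"
        using eventually_zero_add[OF N.alg_trunc[OF u' a], of l] by blast
      have f0: "\<exists>K. \<forall>i\<ge>K. ?f i = 0"
        by (rule exI[of _ K0]) (use K0 N.act_zero1[OF b] in simp)
      obtain K1 where K1: "\<forall>i\<ge>K1. act N (p1 w1) (k + int i) (p2 w2) = 0"
        using eventually_zero_add[OF N.trunc[OF a b], of k] by blast
      obtain K2 where K2: "\<forall>i\<ge>K2. act N u (m + int i) (p2 w2) = 0"
        using eventually_zero_add[OF N.trunc[OF u' b], of m] by blast
      have g0: "\<exists>K. \<forall>i\<ge>K. ?g i = 0"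
        by (rule exI[of _ "max K1 K2"]) (use K1 K2 N.act_zero2[OF u'] N.act_zero2[OF a] in simp)
      have "smult ((of_int m :: complex) gchoose i)
        (I (act R1 u (l + int i) w1) (of_int m + n - of_nat i) w2) = q (?f i)" for i
        using I[OF cl[OF u w(1)] w(2), of "l + int i" "m + k - int i"] p1(3)[OF u w(1)] k
          linear_on_smult[OF q(1) N.closed[OF N.alg_closed[OF u' a] b]] by simp
      moreover have "smult ((-1) ^ i * ((of_int l :: complex) gchoose i))
        (act R3 u (l + m - int i) (I w1 (n + of_nat i) w2)
         - smult ((-1) powi l) (I w1 (of_int l + n - of_nat i) (act R2 u (m + int i) w2))) = q (?g i)" for i
      proof -
        have x: "act N (p1 w1) (k + int i) (p2 w2) \<in> mcar N"
          "act N (p1 w1) (l + k - int i) (act N u (m + int i) (p2 w2)) \<in> mcar N"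
          by (intro N.closed a b u')+
        have "q (?g i) = smult ((-1) ^ i * ((of_int l :: complex) gchoose i))
          (q (act N u (l + m - int i) (act N (p1 w1) (k + int i) (p2 w2)))
          - smult ((-1) powi l) (q (act N (p1 w1) (l + k - int i) (act N u (m + int i) (p2 w2)))))"
          using linear_on_smult[OF q(1) vs.subspace_diff[OF N.mod_subspace N.closed[OF u' x(1)] sub(2)[OF N.mod_subspace x(2)]]]
            linear_on_diff[OF q(1) N.mod_subspace N.closed[OF u' x(1)] sub(2)[OF N.mod_subspace x(2)]]
            linear_on_smult[OF q(1) x(2)] by simp
        then show ?thesis
          using q(3)[OF u x(1)] I[OF w, of "k + int i"] k
            I[OF w(1) cl2[OF u w(2)], of "l + k - int i" "m + int i"] p2(3)[OF u w(2)] by simp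
      qed
      ultimately show ?thesis
        using linear_on_Sum_any[OF q(1) N.mod_subspace fN f0] linear_on_Sum_any[OF q(1) N.mod_subspace gN g0]
          N.Jacobi[OF u' a b, of m l k] by simp
    next
      case False
      \<comment> \<open>all indices in the identity differ from \<open>n\<close> by integers\<close>
      have 1: "of_int c + n - of_nat i \<notin> \<int>" for c :: int and i :: nat
      proof
        assume "of_int c + n - of_nat i \<in> \<int>"
        then have "(of_int c + n - of_nat i) - of_int c + of_nat i \<in> \<int>" by (intro Ints_add Ints_diff) auto
        then show False using False by simp
      qed
      have 2: "n + of_nat i \<notin> \<int>" for i :: nat
        using False Ints_diff[of "n + of_nat i" "of_nat i"] by auto
      show ?thesis
        using I0[OF 1] I0[OF 2] linear_on_0[OF lin3[OF u] subR(3)] by simp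
    qed
  qed
  moreover have "I (Lop (V\<lparr>vcar := P\<rparr>) R1 (-1) w1) n w2 = smult (- n) (I w1 (n - 1) w2)"
    if w: "w1 \<in> mcar R1" "w2 \<in> mcar R2" for w1 w2 n
  proof (cases "n \<in> \<int>")
    case True
    then obtain k where k: "n = of_int k" by (auto elim: Ints_cases)
    have "I (Lop (V\<lparr>vcar := P\<rparr>) R1 (-1) w1) n w2 = q (act N (mode V (conf V) 0 (p1 w1)) k (p2 w2))"
      using I[OF cl[OF conf w(1)] w(2)] p1(3)[OF conf w(1)] by (simp add: Lop_def k)
    also have "\<dots> = smult (- n) (q (act N (p1 w1) (k - 1) (p2 w2)))"
      using deriv[OF p1(2)[OF w(1)] p2(2)[OF w(2)]]
        linear_on_smult[OF q(1) N.closed[OF p1(2)[OF w(1)] p2(2)[OF w(2)]], of "- n"] k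
      by (simp del: vs.scale_minus_left)
    finally show ?thesis using I[OF w, of "k - 1"] k by simp
  next
    case False
    then have "n - 1 \<notin> \<int>" using Ints_add[of "n - 1" 1] by auto
    then show ?thesis using False I0 by simp
  qed
  ultimately show ?thesis unfolding intertwiners_def I_def[symmetric] by simp
qed

text \<open>
  The finite spanning set matters: the library also gives dimension \<open>0\<close> to spaces with an infinite
  basis.
\<close>

lemma dim_zero_imp_zero:
  assumes "finite B" "T \<subseteq> ivs.span B" "ivs.dim T = 0"
  shows "T \<subseteq> {0}"
proof -
  obtain C where C: "C \<subseteq> T" "ivs.independent C" "T \<subseteq> ivs.span C" "card C = ivs.dim T"
    using ivs.basis_exists[of T] by blast
  have "finite C" using ivs.independent_span_bound[OF assms(1) C(2)] C(1) assms(2) by blast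
  then have "C = {}" using C(4) assms(3) by simp
  then show ?thesis using C(3) by simp
qed

text \<open>
  Widening the range of summation beyond the supports makes the product visibly bilinear.
\<close>

lemma fprod_expand:
  assumes "finite X" "Poly_Mapping.keys x \<subseteq> X" "finite Y" "Poly_Mapping.keys y \<subseteq> Y"
  shows "fprod V x y = (\<Sum>a\<in>X. \<Sum>b\<in>Y. \<Sum>c\<in>irr_classes V.
     Poly_Mapping.single c (Poly_Mapping.lookup x a * Poly_Mapping.lookup y b *
       of_nat (fusion_rule V (SOME M. M \<in> a) (SOME M. M \<in> b) (SOME M. M \<in> c))))"
proof -
  have "(\<Sum>b\<in>Poly_Mapping.keys y. \<Sum>c\<in>irr_classes V.
     Poly_Mapping.single c (Poly_Mapping.lookup x a * Poly_Mapping.lookup y b *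
       of_nat (fusion_rule V (SOME M. M \<in> a) (SOME M. M \<in> b) (SOME M. M \<in> c)))) =
    (\<Sum>b\<in>Y. \<Sum>c\<in>irr_classes V.
     Poly_Mapping.single c (Poly_Mapping.lookup x a * Poly_Mapping.lookup y b *
       of_nat (fusion_rule V (SOME M. M \<in> a) (SOME M. M \<in> b) (SOME M. M \<in> c))))" for a
    by (rule sum.mono_neutral_left) (use assms in \<open>auto simp: in_keys_iff\<close>)
  then show ?thesis unfolding fprod_def
    by (simp, intro sum.mono_neutral_left) (use assms in \<open>auto simp: in_keys_iff\<close>)
qed

lemma fprod_add_left: "fprod V (x + y) z = fprod V x z + fprod V y z"
proof -
  let ?X = "Poly_Mapping.keys x \<union> Poly_Mapping.keys y"
  let ?Z = "Poly_Mapping.keys z"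
  have "Poly_Mapping.keys (x + y) \<subseteq> ?X" by (rule Poly_Mapping.keys_add)
  then show ?thesis
    by (simp add: fprod_expand[of ?X _ ?Z] lookup_add algebra_simps single_add sum.distrib)
qed

lemma fprod_smult_left: "fprod V (smult c x) z = smult c (fprod V x z)"
proof -
  let ?X = "Poly_Mapping.keys x"
  let ?Z = "Poly_Mapping.keys z"
  have k: "Poly_Mapping.keys (smult c x) \<subseteq> ?X" by (auto simp: in_keys_iff)
  have s: "smult c (Poly_Mapping.single a b) = Poly_Mapping.single a (c * b)" for a :: "vmod set" and b
    by (rule poly_mapping_eqI) (simp add: lookup_single when_def)
  show ?thesis
    using k by (simp add: fprod_expand[of ?X _ ?Z] vs.scale_sum_right s mult.assoc)
qed

lemma fusion_coefficient:
  assumes fin: "finite (irr_classes V)" and M: "irreducible_module V M3"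
  shows "Poly_Mapping.lookup (fprod V (fbasis V M1) (fbasis V M2)) (fclass V M3) =
    of_nat (fusion_rule V (SOME M. M \<in> fclass V M1) (SOME M. M \<in> fclass V M2) (SOME M. M \<in> fclass V M3))"
proof -
  have c: "fclass V M3 \<in> irr_classes V" using M by (simp add: irr_classes_def)
  have "Poly_Mapping.keys (fbasis V M1) = {fclass V M1}" "Poly_Mapping.keys (fbasis V M2) = {fclass V M2}"
    by (simp_all add: fbasis_def)
  then have "fprod V (fbasis V M1) (fbasis V M2) = (\<Sum>c\<in>irr_classes V.
     Poly_Mapping.single c (of_nat (fusion_rule V (SOME M. M \<in> fclass V M1) (SOME M. M \<in> fclass V M2) (SOME M. M \<in> c))))"
    by (simp add: fprod_def) (simp add: fbasis_def)
  then show ?thesis using fin c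
    by (simp add: Poly_Mapping.lookup_sum lookup_single when_def sum.delta)
qed

lemma fclass_eq_imp_iso:
  assumes "irreducible_module V M" "fclass V M = fclass V N"
  shows "module_iso V N M"
proof -
  have "M \<in> fclass V M" using assms(1) module_iso_refl by (simp add: fclass_def)
  then have "M \<in> fclass V N" using assms(2) by simp
  then show ?thesis by (simp add: fclass_def)
qed

lemma irreducible_module_iso_sym:
  assumes "irreducible_module V M" "module_iso V M N"
  shows "module_iso V N M"
  using module_iso_sym[OF assms(2)] is_moduleD(1,2)[of V M] assms(1)
  by (simp add: irreducible_module_def bilinear_into_def)

text \<open>
  The way fusion coefficients are used: if \<open>M3\<close> does not occur in \<open>M1 \<boxtimes> M2\<close>, then the action of
  \<open>M1 \<subseteq> V\<close> on \<open>M2 \<subseteq> N\<close> followed by a \<open>P\<close>-equivariant projection to \<open>M3\<close> is zero.  The fusion rule is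
  computed with chosen representatives of the three classes, so the action is moved to them along
  isomorphisms.
\<close>

lemma vanishing_fusion_rule:
  assumes N: "vertex_action V N" and P: "P \<subseteq> vcar V" and conf: "conf V \<in> P"
    and deriv: "\<And>u w n. u \<in> vcar V \<Longrightarrow> w \<in> mcar N \<Longrightarrow>
        act N (mode V (conf V) 0 u) n w = smult (- of_int n) (act N u (n - 1) w)"
    and U: "U = V\<lparr>vcar := P\<rparr>" "has_fusion_algebra U"
    and irr: "irreducible_module U M1" "irreducible_module U M2" "irreducible_module U M3"
    and zero: "Poly_Mapping.lookup (fprod U (fbasis U M1) (fbasis U M2)) (fclass U M3) = 0"
    and M1: "mcar M1 \<subseteq> vcar V" "\<And>u n v. u \<in> P \<Longrightarrow> v \<in> mcar M1 \<Longrightarrow> act M1 u n v = mode V u n v"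
    and M2: "mcar M2 \<subseteq> mcar N" "\<And>u n v. u \<in> P \<Longrightarrow> v \<in> mcar M2 \<Longrightarrow> act M2 u n v = act N u n v"
    and pr: "linear_on (mcar N) \<pi>" "\<And>x. x \<in> mcar N \<Longrightarrow> \<pi> x \<in> mcar M3"
      "\<And>u n x. u \<in> P \<Longrightarrow> x \<in> mcar N \<Longrightarrow> \<pi> (act N u n x) = act M3 u n (\<pi> x)"
    and u: "u \<in> mcar M1" and w: "w \<in> mcar M2"
  shows "\<pi> (act N u n w) = 0"
proof -
  define r where "r M = (SOME R. R \<in> fclass U M)" for M
  have r: "irreducible_module U (r M)" "module_iso U M (r M)" if "irreducible_module U M" for M
  proof -
    have "M \<in> fclass U M" using that module_iso_refl by (simp add: fclass_def)
    then have "r M \<in> fclass U M" unfolding r_def by (rule someI)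
    then show "irreducible_module U (r M)" "module_iso U M (r M)" by (simp_all add: fclass_def)
  qed
  have Upar: "vcar U = P" by (simp add: U)
  note r1 = r[OF irr(1)] and r2 = r[OF irr(2)] and r3 = r[OF irr(3)]
  obtain p1 where p1: "bij_betw p1 (mcar (r M1)) (mcar M1)" "linear_on (mcar (r M1)) p1"
      "\<forall>u\<in>P. \<forall>n. \<forall>w\<in>mcar (r M1). p1 (act (r M1) u n w) = act M1 u n (p1 w)"
    using irreducible_module_iso_sym[OF irr(1) r1(2)] unfolding module_iso_def Upar by blast
  obtain p2 where p2: "bij_betw p2 (mcar (r M2)) (mcar M2)" "linear_on (mcar (r M2)) p2"
      "\<forall>u\<in>P. \<forall>n. \<forall>w\<in>mcar (r M2). p2 (act (r M2) u n w) = act M2 u n (p2 w)"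
    using irreducible_module_iso_sym[OF irr(2) r2(2)] unfolding module_iso_def Upar by blast
  obtain g where g: "bij_betw g (mcar M3) (mcar (r M3))" "linear_on (mcar M3) g"
      "\<forall>u\<in>P. \<forall>n. \<forall>w\<in>mcar M3. g (act M3 u n w) = act (r M3) u n (g w)"
    using r3(2) unfolding module_iso_def Upar by blast
  have im1: "p1 x \<in> mcar M1" if "x \<in> mcar (r M1)" for x using p1(1) that by (auto simp: bij_betw_def)
  have im2: "p2 x \<in> mcar M2" if "x \<in> mcar (r M2)" for x using p2(1) that by (auto simp: bij_betw_def)
  have imq: "g x \<in> mcar (r M3)" if "x \<in> mcar M3" for x using g(1) that by (auto simp: bij_betw_def)
  let ?q = "\<lambda>x. g (\<pi> x)"
  have "pulled_back N (r M1) (r M2) p1 p2 ?q \<in> intertwiners (V\<lparr>vcar := P\<rparr>) (r M1) (r M2) (r M3)"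
  proof (rule pulled_back_intertwiner[OF N P conf deriv])
    show "is_module (V\<lparr>vcar := P\<rparr>) (r M1)" "is_module (V\<lparr>vcar := P\<rparr>) (r M2)" "is_module (V\<lparr>vcar := P\<rparr>) (r M3)"
      using r1(1) r2(1) r3(1) by (simp_all add: irreducible_module_def U)
    show "linear_on (mcar N) ?q"
      using pr(1,2) g(2) unfolding linear_on_def by simp
    show "p1 (act (r M1) u n x) = mode V u n (p1 x)" if "u \<in> P" "x \<in> mcar (r M1)" for u n x
      using p1(3) M1(2)[OF that(1) im1[OF that(2)]] that by simp
    show "p2 (act (r M2) u n x) = act N u n (p2 x)" if "u \<in> P" "x \<in> mcar (r M2)" for u n x
      using p2(3) M2(2)[OF that(1) im2[OF that(2)]] that by simp
    show "?q (act N u n x) = act (r M3) u n (?q x)" if "u \<in> P" "x \<in> mcar N" for u n x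
      using pr(2,3) g(3) that by simp
  qed (use p1 p2 im1 im2 imq M1 M2 pr in auto)
  moreover have "intertwiners (V\<lparr>vcar := P\<rparr>) (r M1) (r M2) (r M3) \<subseteq> {0}"
  proof -
    have fin: "finite (irr_classes U)" using U(2) by (simp add: has_fusion_algebra_def)
    obtain B where "finite B" "intertwiners U (r M1) (r M2) (r M3) \<subseteq> ivs.span B"
      using U(2) r1(1) r2(1) r3(1) unfolding has_fusion_algebra_def by blast
    moreover have "fusion_rule U (r M1) (r M2) (r M3) = 0"
      using zero fusion_coefficient[OF fin irr(3), of M1 M2] by (simp add: r_def)
    ultimately show ?thesis
      using dim_zero_imp_zero unfolding fusion_rule_def U(1) by blast
  qed
  ultimately have z: "pulled_back N (r M1) (r M2) p1 p2 ?q = 0" by blast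
  obtain x where x: "x \<in> mcar (r M1)" "u = p1 x" using p1(1) u by (auto simp: bij_betw_def)
  obtain y where y: "y \<in> mcar (r M2)" "w = p2 y" using p2(1) w by (auto simp: bij_betw_def)
  have "?q (act N u n w) = pulled_back N (r M1) (r M2) p1 p2 ?q x (of_int n) y"
    using x y by (simp add: pulled_back_def)
  also have "\<dots> = 0" using z by simp
  finally have gz: "g (\<pi> (act N u n w)) = 0" .
  have sub3: "vs.subspace (mcar M3)" using irr(3) is_moduleD(1) by (auto simp: irreducible_module_def)
  have g0: "g 0 = 0" using linear_on_0[OF g(2) sub3] .
  have "\<pi> (act N u n w) \<in> mcar M3"
    using pr(2) vertex_action.closed[OF N] M1 M2 u w by blast
  then show ?thesis
    using g(1) gz g0 vs.subspace_0[OF sub3] by (metis bij_betw_inv_into_left)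
qed

section \<open>The sign automorphism of an algebra with distinct basis classes\<close>

lemma fprod_add_right: "fprod V z (x + y) = fprod V z x + fprod V z y"
proof -
  let ?X = "Poly_Mapping.keys x \<union> Poly_Mapping.keys y"
  let ?Z = "Poly_Mapping.keys z"
  have "Poly_Mapping.keys (x + y) \<subseteq> ?X" by (rule Poly_Mapping.keys_add)
  then show ?thesis
    by (simp add: fprod_expand[of ?Z _ ?X] lookup_add algebra_simps single_add sum.distrib)
qed

lemma fprod_smult_right: "fprod V z (smult c x) = smult c (fprod V z x)"
proof -
  let ?X = "Poly_Mapping.keys x"
  let ?Z = "Poly_Mapping.keys z"
  have k: "Poly_Mapping.keys (smult c x) \<subseteq> ?X" by (auto simp: in_keys_iff)
  have s: "smult c (Poly_Mapping.single a b) = Poly_Mapping.single a (c * b)" for a :: "vmod set" and b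
    by (rule poly_mapping_eqI) (simp add: lookup_single when_def)
  show ?thesis
    using k by (simp add: fprod_expand[of ?Z _ ?X] vs.scale_sum_right s mult.assoc mult.left_commute)
qed

text \<open>
  Every term on the right of a listed rule has the parity of the product of signs on the left.
\<close>

lemma signed_fusion_rules:
  assumes "F1 (fprod V) k B" "F2 (fprod V) k B" "F3 (fprod V) k B" "F4 (fprod V) k B" "k \<ge> 2"
  shows "F1 (fprod V) k (signed B)" "F2 (fprod V) k (signed B)"
    "F3 (fprod V) k (signed B)" "F4 (fprod V) k (signed B)"
proof -
  have pr: "fprod V (signed B i \<epsilon>) (signed B j \<delta>) = smult ((-1) ^ (i + j + \<epsilon> + \<delta>)) (fprod V (B i \<epsilon>) (B j \<delta>))"
    for i j \<epsilon> \<delta>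
    by (simp add: signed_def fprod_smult_left fprod_smult_right power_add mult.commute mult.left_commute)
  show "F1 (fprod V) k (signed B)"
    using assms(1) unfolding F1_def by (auto simp: pr) (auto simp: signed_def)
  show "F2 (fprod V) k (signed B)"
    unfolding F2_def
  proof (intro impI allI)
    fix j assume j: "4 \<le> k" "1 \<le> j \<and> j \<le> k div 2 - 1"
    then obtain i where i: "j = Suc i" by (cases j) auto
    show "fprod V (signed B 1 0) (signed B j 0) = signed B (j - 1) 0 + signed B j 1 + signed B (j + 1) 0"
      using assms(2) j unfolding F2_def pr
      by (simp add: signed_def i vs.scale_right_distrib)
  qed
  obtain n where n: "k div 2 = Suc n" using assms(5) by (cases "k div 2") auto
  show "F3 (fprod V) k (signed B)"
    using assms(3) unfolding F3_def pr n by (simp add: signed_def vs.scale_right_distrib)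
  show "F4 (fprod V) k (signed B)"
    using assms(4) unfolding F4_def pr n by (simp add: signed_def)
qed

text \<open>
  The purely algebraic situation: a fusion algebra with basis elements \<open>B j \<epsilon>\<close> that belong to pairwise
  distinct classes and satisfy the listed rules.
\<close>

locale sigma_type_fusion =
  fixes U :: voa and k :: nat and half_class :: "nat \<Rightarrow> nat \<Rightarrow> vmod set" and B :: "nat \<Rightarrow> nat \<Rightarrow> fvec"
    and S :: "fvec set"
  assumes k: "k \<ge> 2"
    and fusion: "has_fusion_algebra U"
    and B_single: "B j \<epsilon> = Poly_Mapping.single (half_class j \<epsilon>) 1"
    and irr: "j \<le> k div 2 \<Longrightarrow> \<epsilon> \<in> {0,1} \<Longrightarrow> half_class j \<epsilon> \<in> irr_classes U"
    and distinct: "i \<le> k div 2 \<Longrightarrow> j \<le> k div 2 \<Longrightarrow> \<delta> \<in> {0,1} \<Longrightarrow> \<epsilon> \<in> {0,1} \<Longrightarrow>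
      half_class i \<delta> = half_class j \<epsilon> \<Longrightarrow> i = j \<and> \<delta> = \<epsilon>"
    and unit: "B 0 0 = fbasis U (adjoint_mod U)"
    and rules: "F1 (fprod U) k B" "F2 (fprod U) k B" "F3 (fprod U) k B" "F4 (fprod U) k B"
    and S: "S = vs.span {B j \<epsilon> | j \<epsilon>. j \<le> k div 2 \<and> \<epsilon> \<in> {0, 1}}"
begin

abbreviation pr :: "fvec \<Rightarrow> fvec \<Rightarrow> fvec" (infixl "\<odot>" 70) where "pr \<equiv> fprod U"

definition sgn_class :: "vmod set \<Rightarrow> complex" where
  "sgn_class c = (if \<exists>j \<epsilon>. j \<le> k div 2 \<and> \<epsilon> \<in> {0,1} \<and> odd (j + \<epsilon>) \<and> c = half_class j \<epsilon> then -1 else 1)"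

text \<open>
  A diagonal map on the whole fusion algebra: linearity and \<open>\<sigma>\<^sup>2 = 1\<close> are then immediate, and only its
  values on the classes in question depend on their being distinct.
\<close>

definition \<sigma> :: "fvec \<Rightarrow> fvec" where
  "\<sigma> x = Poly_Mapping.mapp (\<lambda>c v. sgn_class c * v) x"

lemma lookup_sigma: "Poly_Mapping.lookup (\<sigma> x) c = sgn_class c * Poly_Mapping.lookup x c"
  by (simp add: \<sigma>_def lookup_mapp when_def in_keys_iff)

lemma sigma_add: "\<sigma> (x + y) = \<sigma> x + \<sigma> y"
  by (rule poly_mapping_eqI) (simp add: lookup_sigma lookup_add algebra_simps)

lemma sigma_smult: "\<sigma> (smult c x) = smult c (\<sigma> x)"
  by (rule poly_mapping_eqI) (simp add: lookup_sigma)

lemma sigma_sigma: "\<sigma> (\<sigma> x) = x"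
  by (rule poly_mapping_eqI) (simp add: lookup_sigma sgn_class_def)

lemma sigma_B:
  assumes "j \<le> k div 2" "\<epsilon> \<in> {0,1}"
  shows "\<sigma> (B j \<epsilon>) = signed B j \<epsilon>"
proof -
  have "sgn_class (half_class j \<epsilon>) = (-1) ^ (j + \<epsilon>)"
  proof (cases "even (j + \<epsilon>)")
    case True
    then have "\<not> (\<exists>i \<delta>. i \<le> k div 2 \<and> \<delta> \<in> {0,1} \<and> odd (i + \<delta>) \<and> half_class j \<epsilon> = half_class i \<delta>)"
      using distinct[OF assms(1) _ assms(2)] by metis
    then show ?thesis using True by (simp add: sgn_class_def)
  next
    case False
    then show ?thesis using assms unfolding sgn_class_def by auto
  qed
  then show ?thesis
    by (intro poly_mapping_eqI) (auto simp: lookup_sigma signed_def B_single lookup_single when_def)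
qed

lemma S_subspace: "vs.subspace S"
  unfolding S by (rule vs.subspace_span)

lemma B_S: "j \<le> k div 2 \<Longrightarrow> \<epsilon> \<in> {0,1} \<Longrightarrow> B j \<epsilon> \<in> S"
  unfolding S by (rule vs.span_base) blast

lemma S_induct [consumes 1, case_names subspace basis]:
  assumes "x \<in> S" "vs.subspace {x. P x}" "\<And>j \<epsilon>. j \<le> k div 2 \<Longrightarrow> \<epsilon> \<in> {0,1} \<Longrightarrow> P (B j \<epsilon>)"
  shows "P x"
proof -
  have "S \<subseteq> {x. P x}" unfolding S by (rule vs.span_minimal) (use assms in auto)
  then show ?thesis using assms(1) by blast
qed

lemma sigma_S: "x \<in> S \<Longrightarrow> \<sigma> x \<in> S"
proof (induction rule: S_induct)
  case subspace
  show ?case using S_subspace sigma_smult[of 0 0]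
    by (auto simp: vs.subspace_def sigma_add sigma_smult)
next
  case (basis j \<epsilon>)
  then show ?case using vs.subspace_scale[OF S_subspace B_S] by (simp add: sigma_B signed_def)
qed

lemma S_fusion_space: "x \<in> S \<Longrightarrow> x \<in> fusion_space U"
proof (induction rule: S_induct)
  case subspace
  have "Poly_Mapping.keys (smult c x) \<subseteq> Poly_Mapping.keys x" for c and x :: fvec
    by (auto simp: in_keys_iff)
  moreover have "Poly_Mapping.keys (x + y) \<subseteq> Poly_Mapping.keys x \<union> Poly_Mapping.keys y" for x y :: fvec
    by (rule Poly_Mapping.keys_add)
  ultimately show ?case unfolding vs.subspace_def fusion_space_def by simp blast
next
  case (basis j \<epsilon>)
  then show ?case using irr by (simp add: fusion_space_def B_single)
qed

lemma pr_commute: "x \<in> S \<Longrightarrow> y \<in> S \<Longrightarrow> x \<odot> y = y \<odot> x"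
  using fusion S_fusion_space unfolding has_fusion_algebra_def by blast

lemma pr_assoc: "x \<in> S \<Longrightarrow> y \<in> S \<Longrightarrow> z \<in> S \<Longrightarrow> x \<odot> y \<odot> z = x \<odot> (y \<odot> z)"
  using fusion S_fusion_space unfolding has_fusion_algebra_def by blast

lemma pr_left_commute:
  assumes "x \<in> S" "y \<in> S" "z \<in> S"
  shows "x \<odot> (y \<odot> z) = y \<odot> (x \<odot> z)"
  using pr_assoc[OF assms] pr_assoc[OF assms(2,1,3)] pr_commute[OF assms(1,2)] by simp

definition multiplicative :: "fvec \<Rightarrow> fvec \<Rightarrow> bool" where
  "multiplicative y z \<longleftrightarrow> y \<odot> z \<in> S \<and> \<sigma> (y \<odot> z) = \<sigma> y \<odot> \<sigma> z"

text \<open>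
  The elements for which \<open>S\<close> is stable and \<open>\<sigma>\<close> multiplicative.  They form a subspace closed under
  products, so it suffices to find generators of \<open>S\<close> among them.
\<close>

definition multipliers :: "fvec set" where
  "multipliers = {y \<in> S. \<forall>z\<in>S. multiplicative y z}"

lemma zero_pr: "0 \<odot> z = 0" "z \<odot> 0 = 0"
  using fprod_smult_left[of U 0 0 z] fprod_smult_right[of U z 0 0] by simp_all

lemma sigma_0: "\<sigma> 0 = 0"
  using sigma_smult[of 0 0] by simp

lemma multipliers_I:
  assumes "y \<in> S" "\<And>j \<epsilon>. j \<le> k div 2 \<Longrightarrow> \<epsilon> \<in> {0,1} \<Longrightarrow> multiplicative y (B j \<epsilon>)"
  shows "y \<in> multipliers"
  unfolding multipliers_def
proof (intro CollectI conjI ballI assms(1))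
  fix z assume "z \<in> S"
  then show "multiplicative y z"
  proof (induction rule: S_induct)
    case subspace
    show ?case unfolding vs.subspace_def multiplicative_def
      using vs.subspace_0[OF S_subspace] vs.subspace_add[OF S_subspace] vs.subspace_scale[OF S_subspace]
      by (auto simp: zero_pr sigma_0 sigma_add sigma_smult fprod_add_right fprod_smult_right)
  next
    case (basis j \<epsilon>)
    then show ?case by (rule assms(2))
  qed
qed

lemma multipliers_subspace: "vs.subspace multipliers"
  unfolding vs.subspace_def multipliers_def multiplicative_def
  using vs.subspace_0[OF S_subspace] vs.subspace_add[OF S_subspace] vs.subspace_scale[OF S_subspace]
  by (auto simp: zero_pr sigma_0 sigma_add sigma_smult fprod_add_left fprod_smult_left)

lemma multipliers_S: "y \<in> multipliers \<Longrightarrow> y \<in> S"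
  by (simp add: multipliers_def)

lemma multipliers_D: "y \<in> multipliers \<Longrightarrow> z \<in> S \<Longrightarrow> y \<odot> z \<in> S \<and> \<sigma> (y \<odot> z) = \<sigma> y \<odot> \<sigma> z"
  by (simp add: multipliers_def multiplicative_def)

lemma multipliers_mult:
  assumes y: "y \<in> multipliers" and y': "y' \<in> multipliers"
  shows "y \<odot> y' \<in> multipliers"
  unfolding multipliers_def multiplicative_def
proof (intro CollectI conjI ballI)
  show "y \<odot> y' \<in> S" using multipliers_D[OF y multipliers_S[OF y']] by simp
  fix z assume z: "z \<in> S"
  note S3 = multipliers_S[OF y] multipliers_S[OF y'] z
  note yz = multipliers_D[OF y' z]
  show "y \<odot> y' \<odot> z \<in> S" using pr_assoc[OF S3] multipliers_D[OF y] yz by simp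
  have "\<sigma> (y \<odot> y' \<odot> z) = \<sigma> y \<odot> (\<sigma> y' \<odot> \<sigma> z)"
    using pr_assoc[OF S3] multipliers_D[OF y] yz by simp
  also have "\<dots> = \<sigma> y \<odot> \<sigma> y' \<odot> \<sigma> z"
    by (rule pr_assoc[symmetric]) (use sigma_S S3 in auto)
  also have "\<dots> = \<sigma> (y \<odot> y') \<odot> \<sigma> z" using multipliers_D[OF y multipliers_S[OF y']] by simp
  finally show "\<sigma> (y \<odot> y' \<odot> z) = \<sigma> (y \<odot> y') \<odot> \<sigma> z" .
qed

lemmas signed_rules = signed_fusion_rules[OF rules k]

lemma m: "1 \<le> k div 2"
  using k by simp

lemma unit_multiplier: "\<epsilon> \<in> {0,1} \<Longrightarrow> B 0 \<epsilon> \<in> multipliers"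
proof (rule multipliers_I)
  assume e: "\<epsilon> \<in> {0,1}"
  show "B 0 \<epsilon> \<in> S" using B_S[of 0 \<epsilon>] e by simp
  fix j \<delta> assume j: "j \<le> k div 2" "\<delta> \<in> {0,1::nat}"
  have d: "(\<epsilon> + \<delta>) mod 2 \<in> {0,1}" by auto
  have "B 0 \<epsilon> \<odot> B j \<delta> = B j ((\<epsilon> + \<delta>) mod 2)"
    "signed B 0 \<epsilon> \<odot> signed B j \<delta> = signed B j ((\<epsilon> + \<delta>) mod 2)"
    using rules(1) signed_rules(1) e j unfolding F1_def by blast+
  then show "multiplicative (B 0 \<epsilon>) (B j \<delta>)"
    using sigma_B[OF j] sigma_B[of 0 \<epsilon>] sigma_B[OF j(1) d] e B_S[OF j(1) d] by (simp add: multiplicative_def)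
qed

lemma B_1: "j \<le> k div 2 \<Longrightarrow> B j 1 = B 0 1 \<odot> B j 0"
  using rules(1) unfolding F1_def by (metis insertI1 insertI2 add.right_neutral mod_less one_less_numeral_iff semiring_norm(76))

text \<open>
  On the \<open>B j 0\<close> this is read off the listed rules and their signed versions.  The \<open>B j 1\<close> follow because
  \<open>B 0 1\<close> carries \<open>B j 0\<close> to \<open>B j 1\<close> and is itself a multiplier.
\<close>

lemma generator_multiplier: "B 1 0 \<in> multipliers"
proof (rule multipliers_I)
  show x: "B 1 0 \<in> S" using B_S[OF m] by simp
  have s: "B 0 1 \<in> S" using B_S[of 0 1] by simp
  have even: "multiplicative (B 1 0) (B j 0)" if j: "j \<le> k div 2" for j
  proof -
    have S0: "B j 0 \<in> S" using B_S[OF j] by simp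
    consider "j = 0" | "1 \<le> j" "j \<le> k div 2 - 1" | "j = k div 2" "odd k" | "j = k div 2" "even k"
      using j by linarith
    then show ?thesis
    proof cases
      case 1
      have u: "B 0 0 \<in> S" using B_S[of 0 0] by simp
      note c = multipliers_D[OF unit_multiplier[of 0] x]
      show ?thesis
        using c pr_commute[OF x u] pr_commute[OF sigma_S[OF x] sigma_S[OF u]] 1
        by (simp add: multiplicative_def)
    next
      case 2
      then have "4 \<le> k" by linarith
      then have "B 1 0 \<odot> B j 0 = B (j - 1) 0 + B j 1 + B (j + 1) 0"
        "signed B 1 0 \<odot> signed B j 0 = signed B (j - 1) 0 + signed B j 1 + signed B (j + 1) 0"
        using rules(2) signed_rules(2) 2 unfolding F2_def by blast+
      moreover have "j - 1 \<le> k div 2" "j + 1 \<le> k div 2" using 2 by auto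
      ultimately show ?thesis
        using sigma_B[of "j - 1" 0] sigma_B[of "j + 1" 0] sigma_B[of j 1] sigma_B[of j 0] sigma_B[of 1 0] j m
          B_S[of "j - 1" 0] B_S[of "j + 1" 0] B_S[of j 1] vs.subspace_add[OF S_subspace]
        by (simp add: multiplicative_def sigma_add)
    next
      case 3
      then have "B 1 0 \<odot> B j 0 = B (j - 1) 0 + B j 1"
        "signed B 1 0 \<odot> signed B j 0 = signed B (j - 1) 0 + signed B j 1"
        using rules(3) signed_rules(3) unfolding F3_def by blast+
      moreover have "j - 1 \<le> k div 2" using 3 by auto
      ultimately show ?thesis
        using sigma_B[of "j - 1" 0] sigma_B[of j 1] sigma_B[of j 0] sigma_B[of 1 0] j m
          B_S[of "j - 1" 0] B_S[of j 1] vs.subspace_add[OF S_subspace]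
        by (simp add: multiplicative_def sigma_add)
    next
      case 4
      then have "B 1 0 \<odot> B j 0 = B (j - 1) 0" "signed B 1 0 \<odot> signed B j 0 = signed B (j - 1) 0"
        using rules(4) signed_rules(4) unfolding F4_def by blast+
      moreover have "j - 1 \<le> k div 2" using 4 by auto
      ultimately show ?thesis
        using sigma_B[of "j - 1" 0] sigma_B[of j 0] sigma_B[of 1 0] j m B_S[of "j - 1" 0]
        by (simp add: multiplicative_def)
    qed
  qed
  fix j \<epsilon> assume j: "j \<le> k div 2" "\<epsilon> \<in> {0,1::nat}"
  show "multiplicative (B 1 0) (B j \<epsilon>)"
  proof (cases "\<epsilon> = 0")
    case True
    then show ?thesis using even[OF j(1)] by simp
  next
    case False
    then have e: "B j \<epsilon> = B 0 1 \<odot> B j 0" using B_1[OF j(1)] j(2) by auto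
    have y: "B j 0 \<in> S" using B_S[OF j(1)] by simp
    note ev = even[OF j(1), unfolded multiplicative_def]
    have sT: "B 0 1 \<in> multipliers" using unit_multiplier[of 1] by simp
    have "B 1 0 \<odot> B j \<epsilon> = B 0 1 \<odot> (B 1 0 \<odot> B j 0)" unfolding e by (rule pr_left_commute[OF x s y])
    moreover have "\<sigma> (B 1 0) \<odot> \<sigma> (B j \<epsilon>) = \<sigma> (B 0 1) \<odot> (\<sigma> (B 1 0) \<odot> \<sigma> (B j 0))"
      using pr_left_commute[OF sigma_S[OF x] sigma_S[OF s] sigma_S[OF y]] multipliers_D[OF sT y] e by simp
    ultimately show ?thesis using multipliers_D[OF sT] ev by (simp add: multiplicative_def)
  qed
qed

text \<open>
  The rule for \<open>B 1 0 \<odot> B i 0\<close> expresses \<open>B (i + 1) 0\<close> by products of multipliers with smaller index.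
\<close>

lemma B_0_multiplier: "j \<le> k div 2 \<Longrightarrow> B j 0 \<in> multipliers"
proof (induction j rule: less_induct)
  case (less j)
  show ?case
  proof (cases "j \<le> 1")
    case True
    then show ?thesis using unit_multiplier[of 0] generator_multiplier by (auto simp: le_Suc_eq)
  next
    case False
    define i where "i = j - 1"
    then have i: "j = i + 1" "1 \<le> i" "i \<le> k div 2 - 1" using False less.prems by auto
    then have "4 \<le> k" using less.prems by linarith
    then have "B 1 0 \<odot> B i 0 = B (i - 1) 0 + B i 1 + B j 0"
      using rules(2) i unfolding F2_def by blast
    moreover have "B i 1 = B 0 1 \<odot> B i 0" using B_1[of i] i less.prems by simp
    ultimately have "B j 0 = B 1 0 \<odot> B i 0 - B 0 1 \<odot> B i 0 - B (i - 1) 0" by (simp add: algebra_simps)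
    moreover have "B i 0 \<in> multipliers" "B (i - 1) 0 \<in> multipliers" using less i by auto
    ultimately show ?thesis
      using multipliers_mult generator_multiplier unit_multiplier[of 1] vs.subspace_diff[OF multipliers_subspace] by simp
  qed
qed

lemma multipliers_eq: "multipliers = S"
proof
  show "multipliers \<subseteq> S" using multipliers_S by blast
  have B_multiplier: "B j \<epsilon> \<in> multipliers" if "j \<le> k div 2" "\<epsilon> \<in> {0,1}" for j \<epsilon>
    using that B_0_multiplier[OF that(1)] B_1[OF that(1)] multipliers_mult[OF unit_multiplier[of 1]] by auto
  show "S \<subseteq> multipliers"
  proof
    fix x assume "x \<in> S"
    then show "x \<in> multipliers" by (induction rule: S_induct) (use multipliers_subspace B_multiplier in auto)
  qed
qed

lemma subalgebra: "fusion_subalgebra U S"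
  unfolding fusion_subalgebra_def
  using S_subspace S_fusion_space unit B_S[of 0 0] multipliers_D multipliers_eq by auto

lemma automorphism: "algebra_automorphism U S \<sigma>"
  unfolding algebra_automorphism_def
proof (intro conjI ballI)
  show "bij_betw \<sigma> S S"
    by (rule bij_betw_byWitness[where f' = \<sigma>]) (use sigma_S sigma_sigma in auto)
  show "linear_on S \<sigma>" by (simp add: linear_on_def sigma_add sigma_smult)
  show "\<sigma> (fbasis U (adjoint_mod U)) = fbasis U (adjoint_mod U)"
    using sigma_B[of 0 0] unit by (simp add: signed_def)
  show "\<sigma> (x \<odot> y) = \<sigma> x \<odot> \<sigma> y" if "x \<in> S" "y \<in> S" for x y
    using multipliers_D multipliers_eq that by blast
qed

lemma order_two: "has_order_two S \<sigma>"
  unfolding has_order_two_def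
proof (intro conjI ballI bexI)
  show "\<sigma> (\<sigma> x) = x" for x by (rule sigma_sigma)
  show "B 0 1 \<in> S" using B_S[of 0 1] by simp
  have "Poly_Mapping.lookup (\<sigma> (B 0 1)) (half_class 0 1) \<noteq> Poly_Mapping.lookup (B 0 1) (half_class 0 1)"
    using sigma_B[of 0 1] by (simp add: signed_def B_single)
  then show "\<sigma> (B 0 1) \<noteq> B 0 1" by metis
qed

end

section \<open>The parafermion coset\<close>

lemma adjoint_vertex_action: "is_voa V \<Longrightarrow> vertex_action V (adjoint_mod V)"
  by (rule is_module_imp_vertex_action) (simp_all add: is_voa_def)

text \<open>
  A vector commutes with the vertex subalgebra generated by \<open>h\<close> as soon as it commutes with \<open>h\<close>.
\<close>

lemma heisenberg_commutant:
  assumes V: "is_voa V" and h: "h \<in> vcar V"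
  shows "commutant V (gen_subalg V {h}) = {v \<in> vcar V. \<forall>n\<ge>0. mode V h n v = 0}"
proof -
  interpret vertex_action V "adjoint_mod V" by (rule adjoint_vertex_action[OF V])
  have vac: "vac V \<in> vcar V" using V by (simp add: is_voa_def)
  have ad: "act (adjoint_mod V) = mode V" "mcar (adjoint_mod V) = vcar V"
    by (simp_all add: adjoint_mod_def)
  have vac_act: "mode V (vac V) n v = 0" if "n \<ge> 0" "v \<in> vcar V" for n v
    using V that unfolding is_voa_def is_module_def ad by simp
  have "u \<in> vcar V \<and> (\<forall>n\<ge>0. mode V u n v = 0)"
    if "u \<in> gen_subalg V {h}" and v: "v \<in> vcar V" "\<forall>n\<ge>0. mode V h n v = 0" for u v
    using that(1)
  proof (induction rule: gen_subalg.induct)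
    case gen_vac
    then show ?case using vac vac_act v by simp
  next
    case (gen_base w)
    then show ?case using h v by simp
  next
    case (gen_add a b)
    then show ?case using vs.subspace_add[OF alg_subspace] linear_on_add[OF linear1, unfolded ad, OF v(1)] by simp
  next
    case (gen_smult a c)
    then show ?case using vs.subspace_scale[OF alg_subspace] linear_on_smult[OF linear1, unfolded ad, OF v(1)] by simp
  next
    case (gen_mode a b n)
    then show ?case using alg_closed iterate_zero[unfolded ad, of a b v] v by blast
  qed
  then show ?thesis unfolding commutant_def using gen_base[of h "{h}" V] by blast
qed

text \<open>
  Modes of vectors in the commutant commute with all \<open>h(n)\<close>, so they preserve the spaces cut out by
  conditions on the \<open>h(n)\<close>.
\<close>

lemma parafermion_vertex_action:
  assumes V: "is_voa V" and h: "h \<in> vcar V" and W: "is_module V (W i)"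
  shows "vertex_action (parafermion k V h) (Mij h W i j)"
proof -
  let ?K = "parafermion k V h" and ?M = "Mij h W i j"
  interpret ad: vertex_action V "adjoint_mod V" by (rule adjoint_vertex_action[OF V])
  interpret W: vertex_action V "W i" by (rule is_module_imp_vertex_action[OF V W])
  have ad: "act (adjoint_mod V) = mode V" "mcar (adjoint_mod V) = vcar V"
    by (simp_all add: adjoint_mod_def)
  have K: "vcar ?K = {v \<in> vcar V. \<forall>n\<ge>0. mode V h n v = 0}" "mode ?K = mode V"
    using heisenberg_commutant[OF V h] by (simp_all add: parafermion_def)
  have M: "mcar ?M = {v \<in> mcar (W i). act (W i) h 0 v = smult (of_int (int i - 2 * j)) v \<and>
      (\<forall>n\<ge>1. act (W i) h n v = 0)}" "act ?M = act (W i)"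
    by (simp_all add: Mij_def)
  have KV: "vcar ?K \<subseteq> vcar V" using K by blast
  have MW: "mcar ?M \<subseteq> mcar (W i)" using M by blast
  note lin = ad.linear2[OF h, unfolded ad] and linW = W.linear2[OF h]
  show ?thesis
  proof
    show "vs.subspace (vcar ?K)"
      unfolding K vs.subspace_def
      using vs.subspace_0[OF W.alg_subspace] vs.subspace_add[OF W.alg_subspace]
        vs.subspace_scale[OF W.alg_subspace] linear_on_0[OF lin W.alg_subspace]
        linear_on_add[OF lin] linear_on_smult[OF lin] by simp
    show subM: "vs.subspace (mcar ?M)"
      unfolding M vs.subspace_def
      using vs.subspace_0[OF W.mod_subspace] vs.subspace_add[OF W.mod_subspace]
        vs.subspace_scale[OF W.mod_subspace] linear_on_0[OF linW W.mod_subspace]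
        linear_on_add[OF linW] linear_on_smult[OF linW]
      by (simp add: vs.scale_right_distrib mult.commute)
    show "mode ?K u n v \<in> vcar ?K" if u: "u \<in> vcar ?K" and v: "v \<in> vcar ?K" for u v n
    proof -
      have "mode V h m (mode V u n v) = 0" if "m \<ge> 0" for m
      proof -
        have "mode V h m (mode V u n v) = mode V u n (mode V h m v)"
          by (rule ad.commute[unfolded ad]) (use u v h K in auto)
        also have "\<dots> = 0" using v that u ad.act_zero2 by (simp add: K ad)
        finally show ?thesis .
      qed
      then show ?thesis using u v W.alg_closed by (simp add: K)
    qed
    show "bilinear_into (vcar ?K) (mcar ?M) (mcar ?M) (act ?M)"
      unfolding bilinear_into_def
    proof (intro conjI ballI allI)
      fix u n w assume u: "u \<in> vcar ?K" and w: "w \<in> mcar ?M"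
      have uV: "u \<in> vcar V" and wW: "w \<in> mcar (W i)" using u w KV MW by auto
      have "act (W i) h m (act (W i) u n w) = act (W i) u n (act (W i) h m w)" for m
        by (rule W.commute) (use u w h K MW in auto)
      then show "act ?M u n w \<in> mcar ?M"
        using w W.closed[OF uV wW] linear_on_smult[OF W.linear2[OF uV] wW] W.act_zero2[OF uV]
        by (simp add: M)
    next
      show "linear_on (mcar ?M) (act ?M u n)" if "u \<in> vcar ?K" for u n
        using W.linear2[of u n] that KV MW unfolding linear_on_def M(2) by blast
      show "linear_on (vcar ?K) (\<lambda>u. act ?M u n w)" if "w \<in> mcar ?M" for w n
        using W.linear1[of w n] that KV MW unfolding linear_on_def M(2) by blast
    qed
    show "\<exists>N. \<forall>n\<ge>N. mode ?K u n v = 0" if "u \<in> vcar ?K" "v \<in> vcar ?K" for u v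
      using W.alg_trunc[of u v] that KV K(2) by auto
    show "\<exists>N. \<forall>n\<ge>N. act ?M u n w = 0" if "u \<in> vcar ?K" "w \<in> mcar ?M" for u w
      using W.trunc[of u w] that KV MW M(2) by auto
    show "jacobi (mode ?K) (act ?M) (act ?M) (act ?M) u v w"
      if "u \<in> vcar ?K" "v \<in> vcar ?K" "w \<in> mcar ?M" for u v w
      using W.jac[of u v w] that KV MW K(2) M(2) by auto
  qed
qed

text \<open>
  For \<open>n \<ge> 0\<close> both the Sugawara vector and \<open>h(-1)h / 4k\<close> are sent by \<open>h(n)\<close> to \<open>h\<close> if \<open>n = 1\<close> and to \<open>0\<close>
  otherwise, so their difference is in the commutant of \<open>h\<close>.
\<close>

lemma coset_conformal_vector:
  assumes V: "is_affine_voa k V h e f" and k: "k \<ge> 1"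
  shows "conf (parafermion k V h) \<in> vcar (parafermion k V h)"
proof -
  have voa: "is_voa V" and hef: "h \<in> vcar V" "e \<in> vcar V" "f \<in> vcar V"
    and rep: "affine_sl2_rep k (vcar V) (mode V h) (mode V e) (mode V f)"
    and conf: "conf V = smult (1 / (2 * (of_nat k + 2)))
       (smult (1/2) (mode V h (-1) h) + mode V e (-1) f + mode V f (-1) e)"
    using V by (auto simp: is_affine_voa_def is_Lki_def)
  interpret vertex_action V "adjoint_mod V" by (rule adjoint_vertex_action[OF voa])
  have ad: "act (adjoint_mod V) = mode V" "mcar (adjoint_mod V) = vcar V"
    by (simp_all add: adjoint_mod_def)
  define H E F where "H = mode V h" and "E = mode V e" and "F = mode V f"
  note lH = linear2[OF hef(1), unfolded ad, folded H_def]
    and lE = linear2[OF hef(2), unfolded ad, folded E_def]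
    and lF = linear2[OF hef(3), unfolded ad, folded F_def]
  have vac: "vac V \<in> vcar V" and creation: "\<And>u. u \<in> vcar V \<Longrightarrow> mode V u (-1) (vac V) = u"
    and annih: "\<And>u n. u \<in> vcar V \<Longrightarrow> n \<ge> 0 \<Longrightarrow> mode V u n (vac V) = 0"
    using voa by (simp_all add: is_voa_def)
  have cr: "H (-1) (vac V) = h" "E (-1) (vac V) = e" "F (-1) (vac V) = f"
    using creation hef by (simp_all add: H_def E_def F_def)
  have an: "H n (vac V) = 0" "E n (vac V) = 0" "F n (vac V) = 0" if "n \<ge> 0" for n
    using annih that hef by (simp_all add: H_def E_def F_def)
  have z: "H n 0 = 0" "E n 0 = 0" "F n 0 = 0" for n
    using act_zero2[unfolded ad] hef by (simp_all add: H_def E_def F_def)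
  have cl: "H n v \<in> vcar V" "E n v \<in> vcar V" "F n v \<in> vcar V" if "v \<in> vcar V" for n v
    using alg_closed hef that by (simp_all add: H_def E_def F_def)
  have comm: "\<forall>v\<in>vcar V. \<forall>m n.
      H m (H n v) - H n (H m v) = (if m + n = 0 then smult (2 * of_int m * of_nat k) v else 0) \<and>
      H m (E n v) - E n (H m v) = smult 2 (E (m + n) v) \<and>
      H m (F n v) - F n (H m v) = smult (-2) (F (m + n) v) \<and>
      E m (F n v) - F n (E m v) =
        H (m + n) v + (if m + n = 0 then smult (of_int m * of_nat k) v else 0) \<and>
      E m (E n v) = E n (E m v) \<and> F m (F n v) = F n (F m v)"
    using rep unfolding affine_sl2_rep_def H_def E_def F_def by (elim conjE)
  have HH: "H m (H n v) = H n (H m v) + (if m + n = 0 then smult (2 * of_int m * of_nat k) v else 0)"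
    and HE: "H m (E n v) = E n (H m v) + smult 2 (E (m + n) v)"
    and HF: "H m (F n v) = F n (H m v) - smult 2 (F (m + n) v)"
    and EF: "E m (F n v) = F n (E m v) + H (m + n) v + (if m + n = 0 then smult (of_int m * of_nat k) v else 0)"
    if v: "v \<in> vcar V" for m n v
  proof -
    have "H m (H n v) - H n (H m v) = (if m + n = 0 then smult (2 * of_int m * of_nat k) v else 0)"
      and "H m (E n v) - E n (H m v) = smult 2 (E (m + n) v)"
      and "H m (F n v) - F n (H m v) = smult (-2) (F (m + n) v)"
      and "E m (F n v) - F n (E m v) =
        H (m + n) v + (if m + n = 0 then smult (of_int m * of_nat k) v else 0)"
      using comm v by blast+
    then show "H m (H n v) = H n (H m v) + (if m + n = 0 then smult (2 * of_int m * of_nat k) v else 0)"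
      and "H m (E n v) = E n (H m v) + smult 2 (E (m + n) v)"
      and "H m (F n v) = F n (H m v) - smult 2 (F (m + n) v)"
      and "E m (F n v) = F n (E m v) + H (m + n) v + (if m + n = 0 then smult (of_int m * of_nat k) v else 0)"
      unfolding diff_eq_eq by (simp_all only: vs.scale_minus_left add.assoc add.commute add.left_commute diff_conv_add_uminus)
  qed
  note sm = linear_on_smult[OF lH] linear_on_smult[OF lE] linear_on_smult[OF lF]
  have hh: "H n (H (-1) h) = (if n = 1 then smult (4 * of_nat k) h else 0)" if "n \<ge> 0" for n
  proof -
    have "H n h = (if n = 1 then smult (2 * of_nat k) (vac V) else 0)"
      using HH[OF vac, of n "-1"] an[OF that] z by (simp add: cr)
    then show ?thesis
      using HH[OF hef(1), of n "-1"] z sm(1)[OF vac] cr(1) by (simp flip: vs.scale_left_distrib)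
  qed
  have hef': "H n (E (-1) f) + H n (F (-1) e) = (if n = 1 then smult 4 h else 0)" if n: "n \<ge> 0" for n
  proof -
    have hf: "H n f = - smult 2 (F (n - 1) (vac V))" using HF[OF vac, of n "-1"] an[OF n] z by (simp add: cr)
    have he: "H n e = smult 2 (E (n - 1) (vac V))" using HE[OF vac, of n "-1"] an[OF n] z by (simp add: cr)
    have ef: "E (n - 1) f = F (-1) (E (n - 1) (vac V)) + H (n - 2) (vac V)
        + (if n = 2 then smult (of_nat k) (vac V) else 0)"
      using EF[OF vac, of "n - 1" "-1"] by (auto simp: cr)
    have fe: "F (n - 1) e = E (-1) (F (n - 1) (vac V)) - H (n - 2) (vac V)
        + (if n = 2 then smult (of_nat k) (vac V) else 0)"
      using EF[OF vac, of "-1" "n - 1"] by (auto simp: cr)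
    have 1: "H n (E (-1) f) = E (-1) (H n f) + smult 2 (E (n - 1) f)"
      using HE[OF hef(3), of n "-1"] by simp
    have 2: "H n (F (-1) e) = F (-1) (H n e) - smult 2 (F (n - 1) e)"
      using HF[OF hef(2), of n "-1"] by simp
    have 3: "E (-1) (H n f) = - smult 2 (E (-1) (F (n - 1) (vac V)))"
      unfolding hf using linear_on_minus[OF lE] linear_on_smult[OF lE] cl vac
        vs.subspace_scale[OF alg_subspace] by simp
    have 4: "F (-1) (H n e) = smult 2 (F (-1) (E (n - 1) (vac V)))"
      unfolding he using linear_on_smult[OF lF] cl vac by simp
    have "H n (E (-1) f) + H n (F (-1) e) =
      smult 4 (F (-1) (E (n - 1) (vac V))) - smult 4 (E (-1) (F (n - 1) (vac V))) + smult 4 (H (n - 2) (vac V))"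
      unfolding 1 2 3 4 ef fe
      by (rule poly_mapping_eqI)
        (simp only: lookup_add lookup_minus lookup_uminus lookup_smult, simp add: algebra_simps)
    moreover have "H (n - 2) (vac V) = (if n = 1 then h else H (n - 2) (vac V))"
      using cr by simp
    \<comment> \<open>the case \<open>n = 0\<close>: the order of \<open>e(-1)\<close> and \<open>f(-1)\<close> only matters up to \<open>h(-2)\<close>\<close>
    moreover have "F (-1) e = E (-1) f - H (-2) (vac V)"
      using EF[OF vac, of "-1" "-1"] cr by simp
    ultimately show ?thesis
      using that cr an[of "n - 1"] an[of "n - 2"] z
      by (cases "n = 0"; cases "n = 1") (auto simp: vs.scale_right_diff_distrib)
  qed
  have cf: "conf (parafermion k V h) = smult (1 / (2 * (of_nat k + 2)))
       (smult (1/2) (H (-1) h) + (E (-1) f + F (-1) e)) - smult (1 / (4 * of_nat k)) (H (-1) h)"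
    by (simp add: parafermion_def conf H_def E_def F_def algebra_simps)
  note sub = vs.subspace_add[OF alg_subspace] vs.subspace_scale[OF alg_subspace] vs.subspace_diff[OF alg_subspace]
  have memb: "H (-1) h \<in> vcar V" "E (-1) f \<in> vcar V" "F (-1) e \<in> vcar V"
    using cl hef by auto
  have "H n (conf (parafermion k V h)) = 0" if n: "n \<ge> 0" for n
  proof -
    have "H n (conf (parafermion k V h)) = smult (1 / (2 * (of_nat k + 2)))
       (smult (1/2) (H n (H (-1) h)) + (H n (E (-1) f) + H n (F (-1) e))) - smult (1 / (4 * of_nat k)) (H n (H (-1) h))"
      unfolding cf
      by (simp add: linear_on_diff[OF lH alg_subspace] linear_on_add[OF lH] linear_on_smult[OF lH] memb sub)
    also have "\<dots> = 0"
    proof -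
      have "(2 * of_nat k + 4 :: complex) = of_nat (2 * k + 4)" by simp
      then have "(2 * of_nat k + 4 :: complex) \<noteq> 0" by (simp only: of_nat_eq_0_iff)
      then have "(1 / (2 * (of_nat k + 2))) * ((1/2) * (4 * of_nat k) + 4) - (1 / (4 * of_nat k)) * (4 * of_nat k) = (0::complex)"
        using k by (simp add: distrib_left flip: add_divide_distrib)
      moreover have "smult a (smult (1/2) (H n (H (-1) h)) + (H n (E (-1) f) + H n (F (-1) e))) - smult b (H n (H (-1) h))
          = (if n = 1 then smult (a * ((1/2) * (4 * of_nat k) + 4) - b * (4 * of_nat k)) h else 0)" for a b
        unfolding hh[OF n] hef'[OF n]
        by (simp add: vs.scale_left_diff_distrib vs.scale_left_distrib vs.scale_right_distrib distrib_left)
      ultimately show ?thesis by (simp only: vs.scale_zero_left if_cancel)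
    qed
    finally show ?thesis .
  qed
  moreover have "conf (parafermion k V h) \<in> vcar V"
    unfolding cf by (intro sub memb)
  ultimately show ?thesis
    using heisenberg_commutant[OF voa hef(1)] by (simp add: parafermion_def H_def)
qed

section \<open>The orbifold of the parafermion algebra\<close>

text \<open>
  An isomorphism of the halves commutes with the operator \<open>L(0)\<close> of \<open>M0\<close>.  It would send a top level
  vector, which lies in \<open>A 0\<close>, to a vector of \<open>A 1\<close> with the same weight, again in the top level.
\<close>

lemma top_level_separates_halves:
  assumes split: "sigma_split M0 Mp N A" and conf: "conf M0 \<in> vcar Mp"
  shows "\<not> module_iso Mp (N\<lparr>mcar := A 0\<rparr>) (N\<lparr>mcar := A 1\<rparr>)"
proof
  assume "module_iso Mp (N\<lparr>mcar := A 0\<rparr>) (N\<lparr>mcar := A 1\<rparr>)"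
  then obtain \<phi> where \<phi>: "bij_betw \<phi> (A 0) (A 1)" "linear_on (A 0) \<phi>"
      "\<And>u n w. u \<in> vcar Mp \<Longrightarrow> w \<in> A 0 \<Longrightarrow> \<phi> (act N u n w) = act N u n (\<phi> w)"
    unfolding module_iso_def by auto
  have dim: "vs.dim (top_level M0 N) = 1" and top: "top_level M0 N \<subseteq> A 0" and disj: "A 0 \<inter> A 1 = {0}"
    and N: "mcar N = {x + y | x y. x \<in> A 0 \<and> y \<in> A 1}"
    using split by (simp_all add: sigma_split_def)
  have irr: "irreducible_module Mp (N\<lparr>mcar := A 0\<rparr>)" using split by (simp add: sigma_split_def)
  have sub: "vs.subspace (A 0)"
    using is_moduleD(1)[of Mp "N\<lparr>mcar := A 0\<rparr>"] irr by (simp add: irreducible_module_def)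
  obtain C where C: "C \<subseteq> top_level M0 N" "vs.independent C" "top_level M0 N \<subseteq> vs.span C"
      "card C = vs.dim (top_level M0 N)"
    by (rule vs.basis_exists)
  then obtain t where "C = {t}" using dim by (auto simp: card_1_singleton_iff)
  then have t: "t \<in> top_level M0 N" "t \<noteq> 0" using C vs.dependent_zero[of C] by auto
  have tA: "t \<in> A 0" using t(1) top by blast
  obtain \<mu> where \<mu>: "t \<in> wtspace M0 N \<mu>" "wtspace M0 N \<mu> \<noteq> {0}"
      "\<forall>n::nat\<ge>1. wtspace M0 N (\<mu> - of_nat n) = {0}"
    using t(1) unfolding top_level_def by blast
  have \<phi>t: "\<phi> t \<in> A 1" using \<phi>(1) tA by (auto simp: bij_betw_def)
  have "\<phi> t \<in> mcar N" using N \<phi>t vs.subspace_0[OF sub] by force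
  moreover have "Lop M0 N 0 (\<phi> t) = smult \<mu> (\<phi> t)"
    using \<phi>(3)[OF conf tA, of 1] \<mu>(1) linear_on_smult[OF \<phi>(2) tA] by (simp add: wtspace_def Lop_def)
  ultimately have "\<phi> t \<in> wtspace M0 N \<mu>" by (simp add: wtspace_def)
  then have "\<phi> t \<in> top_level M0 N" using \<mu> unfolding top_level_def by blast
  then have "\<phi> t = 0" using top \<phi>t disj by blast
  then have "\<phi> t = \<phi> 0" using linear_on_0[OF \<phi>(2) sub] by simp
  then show False using \<phi>(1) tA t(2) vs.subspace_0[OF sub] by (auto simp: bij_betw_def inj_on_def)
qed

lemma projection_exists:
  assumes M: "mcar M = {x + y | x y. x \<in> A \<and> y \<in> C}" "\<And>u n. u \<in> P \<Longrightarrow> linear_on (mcar M) (act M u n)"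
    and sub: "vs.subspace A" "vs.subspace C" "A \<inter> C = {0}"
    and cl: "\<And>u n w. u \<in> P \<Longrightarrow> w \<in> A \<Longrightarrow> act M u n w \<in> A"
      "\<And>u n w. u \<in> P \<Longrightarrow> w \<in> C \<Longrightarrow> act M u n w \<in> C"
  obtains \<pi> where "linear_on (mcar M) \<pi>" "\<And>x. x \<in> mcar M \<Longrightarrow> \<pi> x \<in> A" "\<And>x. x \<in> mcar M \<Longrightarrow> x - \<pi> x \<in> C"
    "\<And>u n x. u \<in> P \<Longrightarrow> x \<in> mcar M \<Longrightarrow> \<pi> (act M u n x) = act M u n (\<pi> x)"
proof -
  define \<pi> where "\<pi> x = (THE a. a \<in> A \<and> x - a \<in> C)" for x
  have uniq: "\<pi> x = a" if "a \<in> A" "x - a \<in> C" for x a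
    unfolding \<pi>_def
  proof (rule the_equality)
    fix b assume b: "b \<in> A \<and> x - b \<in> C"
    then have "b - a \<in> A" using vs.subspace_diff[OF sub(1)] that by blast
    moreover have "(x - a) - (x - b) \<in> C" using vs.subspace_diff[OF sub(2)] that b by blast
    then have "b - a \<in> C" by simp
    ultimately have "b - a = 0" using sub(3) by blast
    then show "b = a" by simp
  qed (use that in simp)
  have \<pi>: "\<pi> x \<in> A \<and> x - \<pi> x \<in> C" if x: "x \<in> mcar M" for x
  proof -
    obtain a c where "a \<in> A" "c \<in> C" "x = a + c" using x M(1) by blast
    then show ?thesis using uniq[of a x] by simp
  qed
  show ?thesis
  proof (rule that[of \<pi>])
    show "\<pi> x \<in> A" "x - \<pi> x \<in> C" if "x \<in> mcar M" for x using \<pi>[OF that] by auto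
    show "linear_on (mcar M) \<pi>"
      unfolding linear_on_def
    proof (intro conjI ballI allI)
      fix x y assume "x \<in> mcar M" "y \<in> mcar M"
      then have x: "\<pi> x \<in> A" "x - \<pi> x \<in> C" and y: "\<pi> y \<in> A" "y - \<pi> y \<in> C" using \<pi> by auto
      have "(x - \<pi> x) + (y - \<pi> y) \<in> C" by (rule vs.subspace_add[OF sub(2) x(2) y(2)])
      then have "x + y - (\<pi> x + \<pi> y) \<in> C" by (simp add: algebra_simps)
      then show "\<pi> (x + y) = \<pi> x + \<pi> y" using uniq vs.subspace_add[OF sub(1) x(1) y(1)] by blast
    next
      fix c x assume "x \<in> mcar M"
      then have x: "\<pi> x \<in> A" "x - \<pi> x \<in> C" using \<pi> by auto
      have "smult c (x - \<pi> x) \<in> C" by (rule vs.subspace_scale[OF sub(2) x(2)])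
      then have "smult c x - smult c (\<pi> x) \<in> C" by (simp add: vs.scale_right_diff_distrib)
      then show "\<pi> (smult c x) = smult c (\<pi> x)" using uniq vs.subspace_scale[OF sub(1) x(1)] by blast
    qed
    show "\<pi> (act M u n x) = act M u n (\<pi> x)" if u: "u \<in> P" and xM: "x \<in> mcar M" for u n x
    proof -
      have x: "\<pi> x \<in> A" "x - \<pi> x \<in> C" using \<pi>[OF xM] by auto
      have AM: "\<pi> x \<in> mcar M" using x(1) M(1) vs.subspace_0[OF sub(2)] by force
      have CM: "x - \<pi> x \<in> mcar M" using x(2) M(1) vs.subspace_0[OF sub(1)] by force
      have "act M u n x - act M u n (\<pi> x) = act M u n (x - \<pi> x)"
        using linear_on_add[OF M(2)[OF u] CM AM] by simp
      also have "\<dots> \<in> C" using cl(2)[OF u x(2)] .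
      finally show ?thesis using uniq cl(1)[OF u x(1)] by blast
    qed
  qed
qed

text \<open>
  Below, the module \<open>N j\<close> is \<open>M\<^sup>2\<^sup>j\<^sup>,\<^sup>j\<close>, its halves are the
  \<open>(M\<^sup>2\<^sup>j\<^sup>,\<^sup>j)\<^sup>\<epsilon>\<close>, and \<open>P\<close>, \<open>Q\<close> are the eigenspaces \<open>M\<^sup>0\<^sup>,\<^sup>+\<close>, \<open>M\<^sup>0\<^sup>,\<^sup>-\<close> of \<open>\<theta>\<close>.
\<close>

locale parafermion_orbifold =
  fixes k :: nat and V :: voa and h e f :: vec and W :: "nat \<Rightarrow> vmod"
    and M0 Mp :: voa and \<theta> :: "vec \<Rightarrow> vec"
    and A :: "nat \<Rightarrow> nat \<Rightarrow> vec set"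
    and B :: "nat \<Rightarrow> nat \<Rightarrow> fvec"
  assumes k: "k \<ge> 3"
    and V: "is_affine_voa k V h e f"
    and W: "\<forall>i\<le>k. is_affine_module k i V h e f (W i)"
    and W0: "W 0 = adjoint_mod V"
    and M0: "M0 = parafermion k V h"
    and irr: "\<forall>i\<le>k. \<forall>j. 0 \<le> j \<and> j < int i \<longrightarrow> irreducible_module M0 (Mij h W i j)"
    and inequiv: "\<forall>i\<le>k. \<forall>j. \<forall>i'\<le>k. \<forall>j'. 0 \<le> j \<and> j < int i \<and> 0 \<le> j' \<and> j' < int i' \<and>
                    module_iso M0 (Mij h W i j) (Mij h W i' j') \<longrightarrow> i = i' \<and> j = j'"
    and M00: "module_iso M0 (Mij h W 0 0) (Mij h W k 0)"
    and \<theta>: "is_theta M0 \<theta>"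
    and Mp: "Mp = fixed_voa M0 \<theta>"
    and split: "\<forall>j\<le>k div 2. sigma_split M0 Mp (Mij h W (2 * j) (int j)) (A j)"
    and A0: "A 0 0 = vcar Mp" "A 0 1 = {v \<in> vcar M0. \<theta> v = - v}"
    and fusion: "has_fusion_algebra Mp"
    and B: "B = (\<lambda>j \<epsilon>. fbasis Mp ((Mij h W (2 * j) (int j))\<lparr>mcar := A j \<epsilon>\<rparr>))"
    and F1: "F1 (fprod Mp) k B"
begin

abbreviation "N j \<equiv> Mij h W (2 * j) (int j)"
abbreviation "half j \<epsilon> \<equiv> (N j)\<lparr>mcar := A j \<epsilon>\<rparr>"
abbreviation "P \<equiv> vcar Mp"
abbreviation "Q \<equiv> A 0 1"

lemma voa: "is_voa V" and hV: "h \<in> vcar V"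
  using V by (auto simp: is_affine_voa_def)

lemma action: "i \<le> k \<Longrightarrow> vertex_action M0 (Mij h W i j)"
  unfolding M0 using W
  by (intro parafermion_vertex_action[OF voa hV]) (simp add: is_affine_module_def)

lemma action_N: "j \<le> k div 2 \<Longrightarrow> vertex_action M0 (N j)"
  by (rule action) simp

lemma Mp_eq: "Mp = M0\<lparr>vcar := P\<rparr>"
  by (simp add: Mp fixed_voa_def)

lemma P_eq: "P = {v \<in> vcar M0. \<theta> v = v}"
  by (simp add: Mp fixed_voa_def)

lemma conf_P: "conf M0 \<in> P"
  using coset_conformal_vector[OF V] k \<theta> by (simp add: P_eq M0 is_theta_def automorphism_def)

lemma mode_M0: "act (N 0) = mode M0" "mcar (N 0) = vcar M0"
proof -
  have "{0..} = insert 0 {1::int..}" by auto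
  then have "(\<forall>n\<ge>(0::int). \<psi> n) \<longleftrightarrow> \<psi> 0 \<and> (\<forall>n\<ge>1. \<psi> n)" for \<psi> :: "int \<Rightarrow> bool"
    by (metis atLeast_iff insert_iff)
  then show "mcar (N 0) = vcar M0"
    using heisenberg_commutant[OF voa hV] by (simp add: Mij_def W0 adjoint_mod_def M0 parafermion_def)
  show "act (N 0) = mode M0" by (simp add: Mij_def W0 adjoint_mod_def M0 parafermion_def)
qed

lemma half_irreducible: "j \<le> k div 2 \<Longrightarrow> \<epsilon> \<in> {0,1} \<Longrightarrow> irreducible_module Mp (half j \<epsilon>)"
  using split by (auto simp: sigma_split_def)

lemma half_subspace: "j \<le> k div 2 \<Longrightarrow> \<epsilon> \<in> {0,1} \<Longrightarrow> vs.subspace (A j \<epsilon>)"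
  using half_irreducible[of j \<epsilon>] is_moduleD(1)[of Mp "half j \<epsilon>"] by (simp add: irreducible_module_def)

lemma half_closed:
  assumes "j \<le> k div 2" "\<epsilon> \<in> {0,1}" "u \<in> P" "w \<in> A j \<epsilon>"
  shows "act (N j) u n w \<in> A j \<epsilon>"
  using half_irreducible[OF assms(1,2)] is_moduleD(2)[of Mp "half j \<epsilon>"] assms(3,4)
  by (simp add: irreducible_module_def bilinear_into_def)

lemma half_nontrivial: "j \<le> k div 2 \<Longrightarrow> \<epsilon> \<in> {0,1} \<Longrightarrow> A j \<epsilon> \<noteq> {0}"
  using half_irreducible[of j \<epsilon>] by (simp add: irreducible_module_def)

lemma half_decomp:
  assumes "j \<le> k div 2" "\<epsilon> \<in> {0,1}"
  shows "mcar (N j) = {x + y | x y. x \<in> A j \<epsilon> \<and> y \<in> A j (1 - \<epsilon>)} \<and> A j \<epsilon> \<inter> A j (1 - \<epsilon>) = {0}"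
proof -
  have s: "mcar (N j) = {x + y | x y. x \<in> A j 0 \<and> y \<in> A j 1}" "A j 0 \<inter> A j 1 = {0}"
    using split assms(1) by (simp_all add: sigma_split_def)
  have "{x + y | x y. x \<in> A j 0 \<and> y \<in> A j 1} = {x + y | x y. x \<in> A j 1 \<and> y \<in> A j 0}"
  proof (intro set_eqI iffI; clarify)
    show "\<exists>x' y'. x + y = x' + y' \<and> x' \<in> A j 1 \<and> y' \<in> A j 0" if "x \<in> A j 0" "y \<in> A j 1" for x y
      using that add.commute[of x y] by blast
    show "\<exists>x' y'. x + y = x' + y' \<and> x' \<in> A j 0 \<and> y' \<in> A j 1" if "x \<in> A j 1" "y \<in> A j 0" for x y
      using that add.commute[of x y] by blast
  qed
  then have c: "mcar (N j) = {x + y | x y. x \<in> A j 1 \<and> y \<in> A j 0}" using s(1) by (rule trans[rotated])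
  have d: "A j 1 \<inter> A j 0 = {0}" using s(2) by (simp only: Int_commute)
  have "\<epsilon> = 0 \<or> \<epsilon> = 1" using assms(2) by simp
  then show ?thesis
  proof (elim disjE)
    assume e: "\<epsilon> = 0"
    show ?thesis
      unfolding e diff_zero using s by (rule conjI)
  next
    assume e: "\<epsilon> = 1"
    show ?thesis
      unfolding e diff_self_eq_0 using c d by (rule conjI)
  qed
qed

lemma half_sub: "j \<le> k div 2 \<Longrightarrow> \<epsilon> \<in> {0,1} \<Longrightarrow> A j \<epsilon> \<subseteq> mcar (N j)"
  using half_decomp[of j \<epsilon>] vs.subspace_0[OF half_subspace[of j "1 - \<epsilon>"]] by force

lemma simple_N:
  assumes "j \<le> k div 2"
  shows "simple_action M0 (N j)"
proof -
  have s: "simple_action M0 (Mij h W i l)" if "i \<le> k" "0 \<le> l" "l < int i" for i l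
  proof -
    have "irreducible_module M0 (Mij h W i l)" using irr that by simp
    then show ?thesis unfolding irreducible_module_def simple_action_def by (rule conjunct2)
  qed
  show ?thesis
  proof (cases "j = 0")
    case True
    have "simple_action M0 (Mij h W 0 0)"
      using simple_action_iso[OF s M00] vertex_action.mod_subspace[OF action[of 0 0]] k by simp
    then show ?thesis using True by simp
  next
    case False
    then show ?thesis using s[of "2 * j" "int j"] assms by simp
  qed
qed

text \<open>
  The module \<open>M\<^sup>0\<^sup>,\<^sup>0\<close> is outside the range \<open>j < i\<close> of the classification and enters it as \<open>M\<^sup>k\<^sup>,\<^sup>0\<close>.
\<close>

lemma N_inequivalent:
  assumes "i \<le> k div 2" "j \<le> k div 2" "module_iso M0 (N i) (N j)"
  shows "i = j"
proof -
  have *: False if "l \<noteq> 0" "l \<le> k div 2" "module_iso M0 (N 0) (N l)" for l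
  proof -
    have "module_iso M0 (Mij h W k 0) (Mij h W 0 0)"
      using module_iso_sym[OF M00] vertex_action.mod_subspace[OF action[of 0 0]]
        vertex_action.closed[OF action[of 0 0]] by simp
    then have "module_iso M0 (Mij h W k 0) (N l)"
      using module_iso_trans that(3) by simp
    moreover have "2 * l \<le> k" using that(2) by linarith
    ultimately show False using inequiv[rule_format, of k "2 * l" 0 "int l"] k that by simp
  qed
  have sym: "module_iso M0 (N j) (N i)"
    using module_iso_sym[OF assms(3)] vertex_action.mod_subspace[OF action_N[OF assms(1)]]
      vertex_action.closed[OF action_N[OF assms(1)]] by blast
  show ?thesis
  proof (cases "i = 0 \<or> j = 0")
    case True
    then show ?thesis using *[of i] *[of j] assms sym by metis
  next
    case False
    have "2 * i \<le> k" "2 * j \<le> k" using assms(1,2) by linarith+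
    then have "2 * i = 2 * j" using False
      using inequiv[rule_format, of "2 * i" "2 * j" "int i" "int j"] assms by simp
    then show ?thesis by simp
  qed
qed

definition half_class :: "nat \<Rightarrow> nat \<Rightarrow> vmod set" where
  "half_class j \<epsilon> = fclass Mp (half j \<epsilon>)"

lemma B_single: "B j \<epsilon> = Poly_Mapping.single (half_class j \<epsilon>) 1"
  by (simp add: B fbasis_def half_class_def)

lemma half_class_neq: "j \<le> k div 2 \<Longrightarrow> half_class j 0 \<noteq> half_class j 1"
  using fclass_eq_imp_iso[OF half_irreducible[of j 1], of "half j 0"]
    top_level_separates_halves[of M0 Mp "N j" "A j"] split conf_P by (auto simp: half_class_def)

lemma theta_mode: "u \<in> vcar M0 \<Longrightarrow> v \<in> vcar M0 \<Longrightarrow> \<theta> (mode M0 u n v) = mode M0 (\<theta> u) n (\<theta> v)"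
  using \<theta> by (simp add: is_theta_def automorphism_def)

lemma alg_grading:
  "u \<in> P \<Longrightarrow> v \<in> Q \<Longrightarrow> mode M0 u n v \<in> Q"
  "u \<in> Q \<Longrightarrow> v \<in> P \<Longrightarrow> mode M0 u n v \<in> Q"
  "u \<in> Q \<Longrightarrow> v \<in> Q \<Longrightarrow> mode M0 u n v \<in> P"
proof -
  interpret vertex_action M0 "N 0" by (rule action_N) simp
  have neg1: "mode M0 (- u) n v = - mode M0 u n v" if "u \<in> vcar M0" "v \<in> vcar M0" for u v
    using linear_on_minus[OF linear1] that by (simp add: mode_M0[simplified])
  have neg2: "mode M0 u n (- v) = - mode M0 u n v" if "u \<in> vcar M0" "v \<in> vcar M0" for u v
    using linear_on_minus[OF linear2] that by (simp add: mode_M0[simplified])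
  have neg: "- u \<in> vcar M0" if "u \<in> vcar M0" for u
    using vs.subspace_neg[OF alg_subspace that] .
  show "u \<in> P \<Longrightarrow> v \<in> Q \<Longrightarrow> mode M0 u n v \<in> Q"
    "u \<in> Q \<Longrightarrow> v \<in> P \<Longrightarrow> mode M0 u n v \<in> Q"
    "u \<in> Q \<Longrightarrow> v \<in> Q \<Longrightarrow> mode M0 u n v \<in> P"
    unfolding P_eq A0(2) by (simp_all add: theta_mode alg_closed neg1 neg2 neg)
qed

text \<open>
  For \<open>j = 0\<close> this is the eigenspace decomposition of \<open>\<theta>\<close>.  For \<open>j > 0\<close>, the product of the classes of
  \<open>M\<^sup>0\<^sup>,\<^sup>-\<close> and a half is the class of the other half, which is different; so the component of the action
  that stays in the same half is an intertwining operator of a type with fusion rule \<open>0\<close>.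
\<close>

lemma odd_part_swaps_halves:
  assumes j: "j \<le> k div 2" "\<epsilon> \<in> {0,1}" and u: "u \<in> Q" and w: "w \<in> A j \<epsilon>"
  shows "act (N j) u n w \<in> A j (1 - \<epsilon>)"
proof (cases "j = 0")
  case True
  then show ?thesis
    using alg_grading(2,3)[of u w n] u w j(2) A0(1) by (auto simp: mode_M0[simplified])
next
  case False
  interpret vertex_action M0 "N j" by (rule action_N[OF j(1)])
  have PM: "P \<subseteq> vcar M0" and QM: "Q \<subseteq> vcar M0" unfolding P_eq A0(2) by auto
  have e: "1 - \<epsilon> \<in> {0,1}" by auto
  obtain \<pi> where \<pi>: "linear_on (mcar (N j)) \<pi>" "\<And>x. x \<in> mcar (N j) \<Longrightarrow> \<pi> x \<in> A j \<epsilon>"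
      "\<And>x. x \<in> mcar (N j) \<Longrightarrow> x - \<pi> x \<in> A j (1 - \<epsilon>)"
      "\<And>u n x. u \<in> P \<Longrightarrow> x \<in> mcar (N j) \<Longrightarrow> \<pi> (act (N j) u n x) = act (N j) u n (\<pi> x)"
    by (rule projection_exists[of "N j" "A j \<epsilon>" "A j (1 - \<epsilon>)" P])
      (use half_decomp[OF j] half_subspace[OF j] half_subspace[OF j(1) e] half_closed[OF j]
        half_closed[OF j(1) e] linear2 PM in blast)+
  have "is_module M0 (N j)" using irr False j(1) by (simp add: irreducible_module_def)
  note deriv = is_moduleD(5)[OF this]
  have prod: "fprod Mp (fbasis Mp (half 0 1)) (fbasis Mp (half j \<epsilon>)) = B j ((1 + \<epsilon>) mod 2)"
    using F1 j unfolding F1_def B by blast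
  have e': "(1 + \<epsilon>) mod 2 = 1 - \<epsilon>" using j(2) by auto
  have ne: "half_class j (1 - \<epsilon>) \<noteq> half_class j \<epsilon>" 
  proof (cases "\<epsilon> = 0")
    case True
    then show ?thesis using half_class_neq[OF j(1)] by simp
  next
    case False
    then have "\<epsilon> = 1" using j(2) by simp
    then show ?thesis using half_class_neq[OF j(1)] by simp
  qed
  have "\<pi> (act (N j) u n w) = 0"
  proof (rule vanishing_fusion_rule[OF vertex_action_axioms PM conf_P _ Mp_eq fusion
        half_irreducible[of 0 1] half_irreducible[OF j] half_irreducible[OF j]])
    show "act (N j) (mode M0 (conf M0) 0 v) m x = smult (- of_int m) (act (N j) v (m - 1) x)"
      if "v \<in> vcar M0" "x \<in> mcar (N j)" for v x m
      using deriv that by (simp add: Lop_def adjoint_mod_def)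
    show "Poly_Mapping.lookup (fprod Mp (fbasis Mp (half 0 1)) (fbasis Mp (half j \<epsilon>))) (fclass Mp (half j \<epsilon>)) = 0"
      unfolding prod e' using ne by (simp add: B_single half_class_def lookup_single)
    show "act (half 0 1) v m x = mode M0 v m x" for v m x by (simp add: mode_M0[simplified])
  qed (use QM half_sub[OF j] \<pi> u w in auto)
  moreover have "act (N j) u n w \<in> mcar (N j)" using closed QM half_sub[OF j] u w by blast
  ultimately show ?thesis using \<pi>(3) by fastforce
qed

lemma graded_N:
  assumes j: "j \<le> k div 2" "\<epsilon> \<in> {0,1}"
  shows "graded_action M0 (N j) P Q (A j \<epsilon>) (A j (1 - \<epsilon>))"
proof -
  interpret vertex_action M0 "N j" by (rule action_N[OF j(1)])
  have e: "1 - \<epsilon> \<in> {0,1}" "1 - (1 - \<epsilon>) = \<epsilon>" using j(2) by auto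
  show ?thesis
  proof
    show "vs.subspace P" "vs.subspace Q" using half_subspace[of 0 0] half_subspace[of 0 1] A0(1) by simp_all
    show "vs.subspace (A j \<epsilon>)" "vs.subspace (A j (1 - \<epsilon>))" using half_subspace j e by auto
    show "vcar M0 = {x + y |x y. x \<in> P \<and> y \<in> Q}"
      using half_decomp[of 0 0] mode_M0(2) A0(1) by simp
    show "act (N j) u n w \<in> A j (1 - \<epsilon>)" if "u \<in> Q" "w \<in> A j \<epsilon>" for u n w
      by (rule odd_part_swaps_halves[OF j that])
    show "act (N j) u n w \<in> A j \<epsilon>" if "u \<in> Q" "w \<in> A j (1 - \<epsilon>)" for u n w
      using odd_part_swaps_halves[OF j(1) e(1) that] e(2) by simp
  qed (use half_decomp[OF j] alg_grading half_closed[OF j] half_closed[OF j(1) e(1)] in auto)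
qed

text \<open>
  An isomorphism of halves of \<open>N i\<close> and \<open>N j\<close> extends to \<open>N i\<close> and \<open>N j\<close>, whence \<open>i = j\<close>; the two
  halves of one module are told apart by its top level.
\<close>

lemma half_class_distinct:
  assumes i: "i \<le> k div 2" and j: "j \<le> k div 2" and \<delta>: "\<delta> \<in> {0,1}" and \<epsilon>: "\<epsilon> \<in> {0,1}"
    and eq: "half_class i \<delta> = half_class j \<epsilon>"
  shows "i = j \<and> \<delta> = \<epsilon>"
proof -
  have "module_iso Mp (half i \<delta>) (half j \<epsilon>)"
    using fclass_eq_imp_iso[OF half_irreducible[OF j \<epsilon>]] eq by (simp add: half_class_def)
  then obtain \<phi> where \<phi>: "bij_betw \<phi> (A i \<delta>) (A j \<epsilon>)" "linear_on (A i \<delta>) \<phi>"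
      "\<And>u n w. u \<in> P \<Longrightarrow> w \<in> A i \<delta> \<Longrightarrow> \<phi> (act (N i) u n w) = act (N j) u n (\<phi> w)"
    unfolding module_iso_def by auto
  have "even_intertwined M0 (N i) (N j) P Q (A i \<delta>) (A i (1 - \<delta>)) (A j \<epsilon>) (A j (1 - \<epsilon>)) \<phi>"
    using graded_N[OF i \<delta>] graded_N[OF j \<epsilon>] \<phi>
    by (simp add: even_intertwined_def even_intertwined_axioms_def)
  then have "module_iso M0 (N i) (N j)"
    by (rule even_intertwined.extends) (use simple_N i j half_nontrivial[OF i \<delta>] in auto)
  then have "i = j" using N_inequivalent i j by blast
  moreover have "\<delta> = \<epsilon>"
  proof (rule ccontr)
    assume "\<delta> \<noteq> \<epsilon>"
    then have "half_class j 0 = half_class j 1" using eq \<delta> \<epsilon> \<open>i = j\<close> by auto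
    then show False using half_class_neq[OF j] by blast
  qed
  ultimately show ?thesis by simp
qed

lemma unit: "B 0 0 = fbasis Mp (adjoint_mod Mp)"
proof -
  have "half 0 0 = adjoint_mod Mp"
    using mode_M0(1) A0(1) by (cases "N 0") (simp add: adjoint_mod_def Mp fixed_voa_def)
  then show ?thesis by (simp add: B)
qed

lemma half_class_irr: "j \<le> k div 2 \<Longrightarrow> \<epsilon> \<in> {0,1} \<Longrightarrow> half_class j \<epsilon> \<in> irr_classes Mp"
  using half_irreducible by (simp add: half_class_def irr_classes_def)

end

theorem theorem3p6:
  fixes k :: nat and V :: voa and h e f :: vec and W :: "nat \<Rightarrow> vmod"
    and M0 Mp :: voa and \<theta> :: "vec \<Rightarrow> vec"
    and A :: "nat \<Rightarrow> nat \<Rightarrow> vec set"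
    and B :: "nat \<Rightarrow> nat \<Rightarrow> fvec" and S :: "fvec set"
  assumes k: "k \<ge> 3"
    and V: "is_affine_voa k V h e f"
    and W: "\<forall>i\<le>k. is_affine_module k i V h e f (W i)"
    and W0: "W 0 = adjoint_mod V"
    and M0: "M0 = parafermion k V h"
    and irr: "\<forall>i\<le>k. \<forall>j. 0 \<le> j \<and> j < int i \<longrightarrow> irreducible_module M0 (Mij h W i j)"
    and inequiv: "\<forall>i\<le>k. \<forall>j. \<forall>i'\<le>k. \<forall>j'. 0 \<le> j \<and> j < int i \<and> 0 \<le> j' \<and> j' < int i' \<and>
                    module_iso M0 (Mij h W i j) (Mij h W i' j') \<longrightarrow> i = i' \<and> j = j'"
    and M00: "module_iso M0 (Mij h W 0 0) (Mij h W k 0)"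
    and \<theta>: "is_theta M0 \<theta>"
    and Mp: "Mp = fixed_voa M0 \<theta>"
    and split: "\<forall>j\<le>k div 2. sigma_split M0 Mp (Mij h W (2 * j) (int j)) (A j)"
    and A0: "A 0 0 = vcar Mp" "A 0 1 = {v \<in> vcar M0. \<theta> v = - v}"
    and fusion: "has_fusion_algebra Mp"
    and B: "B = (\<lambda>j \<epsilon>. fbasis Mp ((Mij h W (2 * j) (int j))\<lparr>mcar := A j \<epsilon>\<rparr>))"
    and F1: "F1 (fprod Mp) k B"
    and F2: "F2 (fprod Mp) k B"
    and F3: "F3 (fprod Mp) k B"
    and F4: "F4 (fprod Mp) k B"
    and S: "S = vs.span {B j \<epsilon> | j \<epsilon>. j \<le> k div 2 \<and> \<epsilon> \<in> {0, 1}}"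
  shows "F1 (fprod Mp) k (signed B) \<and> F2 (fprod Mp) k (signed B) \<and>
         F3 (fprod Mp) k (signed B) \<and> F4 (fprod Mp) k (signed B) \<and>
         fusion_subalgebra Mp S \<and>
         (\<exists>\<sigma>. (\<forall>j\<le>k div 2. \<forall>\<epsilon>\<in>{0, 1}. \<sigma> (B j \<epsilon>) = signed B j \<epsilon>) \<and>
              algebra_automorphism Mp S \<sigma> \<and> has_order_two S \<sigma>)"
proof -
  interpret parafermion_orbifold k V h e f W M0 Mp \<theta> A B
    by unfold_locales fact+
  interpret sigma_type_fusion Mp k half_class B S
  proof
    show "k \<ge> 2" using k by simp
  qed (fact fusion B_single half_class_irr half_class_distinct unit F1 F2 F3 F4 S)+
  show ?thesis
    using signed_rules subalgebra automorphism order_two sigma_B by blast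
qed

end
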